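(* Consider the linear control system $z(t+1)=Az(t)+Bu(t)$ with $z=(x^\top,y^\top)^\top\in\mathbb{R}^N$, scalar input $u(t)\in\mathbb{R}$, and $$A=\begin{pmatrix} A_x & A_{xy} \\ A_{yx} & A_y \end{pmatrix},\qquad B=\begin{pmatrix} B_x \\ B_y \end{pmatrix},$$ where $u(t)$ is an i.i.d. Gaussian variable with $\mathrm{E}[u(t)u(t+k)^\top]=0$ for all $k\ne0$ and $\mathrm{E}[zu^\top]=0$, and $z(t)$ is Gaussian. Let $\Sigma_z=\begin{pmatrix}\Sigma_x&\Sigma_{xy}\\ \Sigma_{xy}^\top&\Sigma_y\end{pmatrix}$ be the covariance of $z(t)$, let $\Sigma_u$ be the covariance of the input at time $t$, and let $\Sigma_x^s=\Sigma_y-\Sigma_{xy}^\top\Sigma_x^{-1}\Sigma_{xy}$ be the Schur complement of $\Sigma_x$ in $\Sigma_z$. Then the information transfer from the input $u$ to the state $x$ is $$T_{u\to x}=\frac12\log\frac{|A_{xy}\Sigma_x^sA_{xy}^\top+B_x\Sigma_uB_x^\top|}{|A_{xy}\Sigma_x^sA_{xy}^\top|},$$ where $|\cdot|$ is the determinant.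
   Context: The (one-step) information transfer from the input $u$ to the state $x$, as the system evolves from time $t$ to $t+1$, is $$T_{u\to x}=H(x(t+1)\mid x(t))-H_{\not u}(x(t+1)\mid x(t)),$$ where $H(\cdot\mid\cdot)$ is conditional differential entropy and $H_{\not u}$ is the same conditional entropy when the input $u$ is held frozen (constant), so that $u$ contributes nothing to the conditional covariance of $x(t+1)$ given $x(t)$, while $z(t)$ has the same covariance $\Sigma_z$.
   Formalization: z(t) and u(t) are assumed jointly Gaussian (separately Gaussian and uncorrelated would not suffice), and Σ_x and A_xy Σ_x^s A_xy^T are assumed invertible so that the formula is defined. *)

theory Defs
  imports "HOL-Probability.Probability"
begin

text \<open>
  A vector \<open>z = (x, y)\<close> of stacked blocks is indexed by the sum type \<open>'n + 'm\<close>: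
  \<open>Inl i\<close> are the coordinates of \<open>x\<close>, \<open>Inr j\<close> those of \<open>y\<close>.
\<close>

definition upper_part :: "'c ^ ('n::finite + 'm::finite) \<Rightarrow> 'c ^ 'n" where
  "upper_part z = (\<chi> i. z $ Inl i)"

definition block_matrix ::
    "'c ^ 'k ^ 'n \<Rightarrow> 'c ^ 'l ^ 'n \<Rightarrow> 'c ^ 'k ^ 'm \<Rightarrow> 'c ^ 'l ^ 'm
      \<Rightarrow> 'c ^ ('k::finite + 'l::finite) ^ ('n::finite + 'm::finite)" where
  "block_matrix P Q R S = (\<chi> i j.
     case i of
       Inl a \<Rightarrow> (case j of Inl c \<Rightarrow> P $ a $ c | Inr d \<Rightarrow> Q $ a $ d)
     | Inr b \<Rightarrow> (case j of Inl c \<Rightarrow> R $ b $ c | Inr d \<Rightarrow> S $ b $ d))"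

definition block_column ::
    "'c ^ 'k ^ 'n \<Rightarrow> 'c ^ 'k ^ 'm \<Rightarrow> 'c ^ 'k::finite ^ ('n::finite + 'm::finite)" where
  "block_column P R = (\<chi> i. case i of Inl a \<Rightarrow> P $ a | Inr b \<Rightarrow> R $ b)"

text \<open>The variance may be zero, so point masses count as Gaussian.\<close>

definition gaussian_real :: "'a measure \<Rightarrow> ('a \<Rightarrow> real) \<Rightarrow> bool" where
  "gaussian_real M X \<longleftrightarrow> X \<in> borel_measurable M \<and>
     ((\<exists>\<mu> \<sigma>. \<sigma> > 0 \<and> distributed M lborel X (normal_density \<mu> \<sigma>)) \<or>
      (\<exists>\<mu>. AE \<omega> in M. X \<omega> = \<mu>))"

definition gaussian :: "'a measure \<Rightarrow> ('a \<Rightarrow> 'b::euclidean_space) \<Rightarrow> bool" where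
  "gaussian M X \<longleftrightarrow> X \<in> borel_measurable M \<and> (\<forall>v. gaussian_real M (\<lambda>\<omega>. v \<bullet> X \<omega>))"

definition covariance_matrix ::
    "'a measure \<Rightarrow> ('a \<Rightarrow> real ^ 'n) \<Rightarrow> real ^ 'n ^ 'n::finite" where
  "covariance_matrix M X = (\<chi> i j.
     prob_space.expectation M (\<lambda>\<omega>.
       (X \<omega> $ i - prob_space.expectation M (\<lambda>\<omega>. X \<omega> $ i)) *
       (X \<omega> $ j - prob_space.expectation M (\<lambda>\<omega>. X \<omega> $ j))))"

text \<open>
  The Schur complement of the block \<open>P\<close> in the symmetric matrix with blocks
  \<open>P\<close>, \<open>Q\<close>, \<open>transpose Q\<close>, \<open>S\<close>.
\<close>

definition schur_complement ::
    "real ^ 'n ^ 'n \<Rightarrow> real ^ 'm ^ 'n \<Rightarrow> real ^ 'm ^ 'm \<Rightarrow> real ^ 'm::finite ^ 'm" where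
  "schur_complement P Q S = S - transpose Q ** matrix_inv P ** Q"

text \<open>
  One step of the system. The input is a scalar; \<^term>\<open>vec v :: real ^ 1\<close> is that scalar as a
  vector of length one, so that \<open>B\<close> is a matrix with one column.
\<close>

definition system_step ::
    "real ^ 'k ^ 'k \<Rightarrow> real ^ 1 ^ 'k \<Rightarrow> real ^ 'k \<Rightarrow> real \<Rightarrow> real ^ 'k::finite" where
  "system_step A B z v = A *v z + B *v vec v"

text \<open>
  Conditional differential entropy of \<open>X\<close> given \<open>Y\<close>, i.e. the library's conditional entropy with
  respect to Lebesgue measure, with logarithms to base \<open>b\<close>.
\<close>

abbreviation diff_cond_entropy ::
    "real \<Rightarrow> 'a measure \<Rightarrow> ('a \<Rightarrow> 'b::euclidean_space) \<Rightarrow> ('a \<Rightarrow> 'c::euclidean_space) \<Rightarrow> real" where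
  "diff_cond_entropy b M X Y \<equiv> prob_space.conditional_entropy M b lborel lborel X Y"

text \<open>
  One-step information transfer from the input to the upper part \<open>x\<close> of the state \<open>z\<close>, from time
  \<open>t\<close> to \<open>t + 1\<close>. In the subtracted term the step from \<open>t\<close> to \<open>t + 1\<close> is made from the same
  random state \<open>z t\<close>, but with the input frozen at the constant \<open>c\<close>.
\<close>

definition input_transfer ::
    "real \<Rightarrow> 'a measure \<Rightarrow> real ^ ('n + 'm) ^ ('n + 'm) \<Rightarrow> real ^ 1 ^ ('n + 'm)
      \<Rightarrow> real \<Rightarrow> (nat \<Rightarrow> 'a \<Rightarrow> real ^ ('n::finite + 'm::finite)) \<Rightarrow> nat \<Rightarrow> real" where
  "input_transfer b M A B c z t =
     diff_cond_entropy b M (\<lambda>\<omega>. upper_part (z (Suc t) \<omega>)) (\<lambda>\<omega>. upper_part (z t \<omega>))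
   - diff_cond_entropy b M (\<lambda>\<omega>. upper_part (system_step A B (z t \<omega>) c))
       (\<lambda>\<omega>. upper_part (z t \<omega>))"

end

theory Submission
  imports Defs
begin

text \<open>
  Let \<open>y'\<close> be the residual of the linear regression of \<open>y\<close> on \<open>x\<close>; it is uncorrelated with \<open>x\<close> and has
  covariance \<open>\<Sigma>xs\<close>. Hence \<open>x(t+1) = g(x(t)) + R\<close> with \<open>g\<close> affine and \<open>R = Axy y' + Bx u\<close>, and
  in the frozen step the same holds without the summand \<open>Bx u\<close>. The noise \<open>R\<close> is Gaussian and
  uncorrelated with \<open>x(t)\<close>; whitening both makes them a standard Gaussian vector, whose law is a
  product by uniqueness of characteristic functions. So the conditional entropy of \<open>g(x) + R\<close> given
  \<open>x\<close> is half the logarithm of the determinant of the covariance of \<open>R\<close>, plus a constant that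
  depends only on the dimension and cancels in the difference.
\<close>

text \<open>Two features of the definitions shape the argument. \<open>gaussian\<close> speaks only
  of one-dimensional projections and admits degenerate laws, whereas the conditional entropy is
  evaluated through a joint density. Every density therefore has to be produced: characteristic
  functions identify the standard Gaussian law, and affine changes of variables carry it back to the
  original variables. Degenerate laws are the reason for the positivity arguments. Invertibility of
  \<open>\<Sigma>x\<close> and of \<open>Axy ** \<Sigma>xs ** transpose Axy\<close> is assumed; that
  of the driven noise covariance follows, because the input adds a positive semidefinite summand,
  even if \<open>\<Sigma>u\<close> is zero. Joint Gaussianity of \<open>(z s, u s)\<close> matters:
  it makes the pair of noise and x(t) Gaussian, and only then does zero covariance give
  independence.\<close>

section \<open>Characteristic functions and product laws\<close>

text \<open>Under the probability measure with density proportional to \<open>w\<close>, \<open>X\<close> still has law \<open>D\<close>.\<close>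

lemma (in prob_space) integral_indicator_tilt_pos:
  fixes X w :: "'a \<Rightarrow> real"
  assumes D: "real_distribution D"
    and X [measurable]: "X \<in> borel_measurable M" and w [measurable]: "w \<in> borel_measurable M"
    and w_bounds: "\<And>\<omega>. 1 \<le> w \<omega>" "\<And>\<omega>. w \<omega> \<le> 3"
    and tilt: "\<And>t. (CLINT \<omega>|M. iexp (t * X \<omega>) * of_real (w \<omega>)) = char D t * of_real (expectation w)"
    and B [measurable]: "B \<in> sets borel"
  shows "expectation (\<lambda>\<omega>. indicator B (X \<omega>) * w \<omega>) = measure D B * expectation w"
proof -
  have w_int: "integrable M w"
  proof (rule integrable_const_bound[of _ 3])
    show "AE \<omega> in M. norm (w \<omega>) \<le> 3"
      using order_trans[OF zero_le_one w_bounds(1)] w_bounds(2) by simp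
  qed measurable
  define c where "c = expectation w"
  have c: "1 \<le> c"
    unfolding c_def using integral_mono[of M "\<lambda>_. 1" w] w_int w_bounds by (simp add: prob_space)
  define N where "N = density M (\<lambda>\<omega>. ennreal (w \<omega> / c))"
  have q: "0 \<le> w \<omega> / c" for \<omega>
    using c w_bounds(1)[of \<omega>] by auto
  interpret N: prob_space N
  proof
    have "emeasure N (space N) = (\<integral>\<^sup>+\<omega>. ennreal (w \<omega> / c) \<partial>M)"
      by (simp add: N_def emeasure_density cong: nn_integral_cong)
    also have "\<dots> = ennreal (expectation (\<lambda>\<omega>. w \<omega> / c))"
      using w_int q by (intro nn_integral_eq_integral) auto
    finally show "emeasure N (space N) = 1"
      using c by (simp add: c_def)
  qed
  have XN: "X \<in> borel_measurable N"
    by (simp add: N_def)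
  interpret D: real_distribution D by fact
  interpret NX: real_distribution "distr N borel X"
    using XN by (auto simp: real_distribution_def real_distribution_axioms_def intro: N.prob_space_distr)
  have "char (distr N borel X) = char D"
  proof
    fix t
    have "char (distr N borel X) t = (CLINT \<omega>|N. iexp (t * X \<omega>))"
      using XN by (simp add: char_def integral_distr)
    also have "\<dots> = (CLINT \<omega>|M. (w \<omega> / c) *\<^sub>R iexp (t * X \<omega>))"
      unfolding N_def using q by (intro integral_density) auto
    also have "\<dots> = (CLINT \<omega>|M. iexp (t * X \<omega>) * of_real (w \<omega>) / of_real c)"
      by (rule Bochner_Integration.integral_cong) (auto simp: scaleR_conv_of_real)
    also have "\<dots> = char D t"
      using c by (simp add: tilt c_def del: of_real_mult)
    finally show "char (distr N borel X) t = char D t" .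
  qed
  then have eq: "distr N borel X = D"
    using Levy_uniqueness NX.real_distribution_axioms D by blast
  have "measure D B = (LINT \<omega>|N. indicator B (X \<omega>))"
    using XN integral_distr[of X N borel "indicator B :: real \<Rightarrow> real"] by (simp flip: eq)
  also have "\<dots> = expectation (\<lambda>\<omega>. (w \<omega> / c) *\<^sub>R indicator B (X \<omega>))"
    unfolding N_def using q by (intro integral_density) auto
  also have "\<dots> = expectation (\<lambda>\<omega>. indicator B (X \<omega>) * w \<omega>) / c"
    by (simp add: mult.commute)
  finally show ?thesis
    using c by (simp add: c_def)
qed

text \<open>A signed weight cannot serve as a density. The shifted weight \<open>2 + w\<close> lies
  between 1 and 3, so the positive case applies to it; the constant weight 1 is another instance,
  and subtracting it twice leaves the claim for \<open>w\<close> by linearity.\<close>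

lemma (in prob_space) integral_indicator_tilt:
  fixes X w :: "'a \<Rightarrow> real"
  assumes D: "real_distribution D"
    and X [measurable]: "X \<in> borel_measurable M" and w [measurable]: "w \<in> borel_measurable M"
    and w_bound: "\<And>\<omega>. \<bar>w \<omega>\<bar> \<le> 1"
    and cf: "\<And>t. (CLINT \<omega>|M. iexp (t * X \<omega>)) = char D t"
    and tilt: "\<And>t. (CLINT \<omega>|M. iexp (t * X \<omega>) * of_real (w \<omega>)) = char D t * of_real (expectation w)"
    and B [measurable]: "B \<in> sets borel"
  shows "expectation (\<lambda>\<omega>. indicator B (X \<omega>) * w \<omega>) = measure D B * expectation w"
proof -
  have b1: "1 \<le> 2 + w \<omega>" and b2: "2 + w \<omega> \<le> 3" for \<omega>
    using w_bound[of \<omega>] by auto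
  have w_int: "integrable M w"
    using w_bound by (intro integrable_const_bound[of _ 1]) auto
  have i1: "integrable M (\<lambda>\<omega>. iexp (t * X \<omega>) * of_real (w \<omega>))" for t
    using w_bound by (intro integrable_const_bound[of _ 1]) (auto simp: norm_mult)
  have i2: "integrable M (\<lambda>\<omega>. iexp (t * X \<omega>))" for t
    by (intro integrable_const_bound[of _ 1]) auto
  have i3: "integrable M (\<lambda>\<omega>. indicator B (X \<omega>) * w \<omega>)"
    using w_bound by (intro integrable_const_bound[of _ 1]) (auto simp: indicator_def)
  have i4: "integrable M (\<lambda>\<omega>. indicator B (X \<omega>) :: real)"
    by (intro integrable_const_bound[of _ 1]) (auto simp: indicator_def)
  have 1: "expectation (\<lambda>\<omega>. indicator B (X \<omega>) * (2 + w \<omega>)) = measure D B * expectation (\<lambda>\<omega>. 2 + w \<omega>)"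
  proof (rule integral_indicator_tilt_pos[OF D X _ b1 b2 _ B])
    fix t
    have "(CLINT \<omega>|M. iexp (t * X \<omega>) * of_real (2 + w \<omega>)) =
      (CLINT \<omega>|M. 2 * iexp (t * X \<omega>) + iexp (t * X \<omega>) * of_real (w \<omega>))"
      by (simp add: algebra_simps)
    also have "\<dots> = 2 * char D t + char D t * of_real (expectation w)"
      using i1 i2 by (simp add: cf tilt del: of_real_mult)
    also have "\<dots> = char D t * of_real (expectation (\<lambda>\<omega>. 2 + w \<omega>))"
      using w_int by (simp add: algebra_simps prob_space)
    finally show "(CLINT \<omega>|M. iexp (t * X \<omega>) * of_real (2 + w \<omega>)) = char D t * of_real (expectation (\<lambda>\<omega>. 2 + w \<omega>))" .
  qed measurable
  have 2: "expectation (\<lambda>\<omega>. indicator B (X \<omega>) * 1) = measure D B * expectation (\<lambda>\<omega>. 1)"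
    by (rule integral_indicator_tilt_pos[OF D X _ _ _ _ B]) (auto simp: cf prob_space simp del: of_real_mult)
  have "expectation (\<lambda>\<omega>. indicator B (X \<omega>) * (2 + w \<omega>))
      = 2 * expectation (\<lambda>\<omega>. indicator B (X \<omega>)) + expectation (\<lambda>\<omega>. indicator B (X \<omega>) * w \<omega>)"
    using i3 i4 by (simp add: distrib_left mult.commute[of _ "2::real"])
  with 1 2 w_int show ?thesis
    by (simp add: prob_space algebra_simps)
qed

text \<open>\<open>cos U\<close> and \<open>sin U\<close> are bounded real weights and linear
  combinations of \<open>iexp U\<close> and \<open>iexp (- U)\<close>. The hypothesis at
  \<open>s = 1\<close> and \<open>s = -1\<close> thus shows that both weights leave the
  characteristic function of \<open>X\<close> unchanged up to a factor, while \<open>s = 0\<close>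
  says that \<open>X\<close> has law \<open>D\<close>. Euler's formula puts the two real results
  together.\<close>

lemma (in prob_space) indicator_char_factorization:
  fixes X U :: "'a \<Rightarrow> real"
  assumes D: "real_distribution D"
    and X [measurable]: "X \<in> borel_measurable M" and U [measurable]: "U \<in> borel_measurable M"
    and cf: "\<And>t s. s \<in> {-1, 0, 1} \<Longrightarrow>
      (CLINT \<omega>|M. iexp (t * X \<omega> + s * U \<omega>)) = char D t * (CLINT \<omega>|M. iexp (s * U \<omega>))"
    and B [measurable]: "B \<in> sets borel"
  shows "(CLINT \<omega>|M. indicator B (X \<omega>) *\<^sub>R iexp (U \<omega>)) = of_real (measure D B) * (CLINT \<omega>|M. iexp (U \<omega>))"
proof -
  have int: "integrable M (\<lambda>\<omega>. iexp (f \<omega>))" if [measurable]: "f \<in> borel_measurable M" for f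
    by (intro integrable_const_bound[of _ 1]) auto
  have cfX: "(CLINT \<omega>|M. iexp (t * X \<omega>)) = char D t" for t
    using cf[of 0 t] by (simp add: prob_space)
  have cf1: "(CLINT \<omega>|M. iexp (t * X \<omega> + U \<omega>)) = char D t * (CLINT \<omega>|M. iexp (U \<omega>))" for t
    using cf[of 1 t] by simp
  have cf2: "(CLINT \<omega>|M. iexp (t * X \<omega> - U \<omega>)) = char D t * (CLINT \<omega>|M. iexp (- U \<omega>))" for t
    using cf[of "-1" t] by simp
  have cos_eq: "complex_of_real (cos x) = (iexp x + iexp (- x)) / 2" for x
    by (simp add: cos_of_real[symmetric] cos_exp_eq)
  have sin_eq: "complex_of_real (sin x) = (iexp x - iexp (- x)) / (2 * \<i>)" for x
    by (simp add: sin_of_real[symmetric] sin_exp_eq)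
  have c: "expectation (\<lambda>\<omega>. indicator B (X \<omega>) * cos (U \<omega>)) = measure D B * expectation (\<lambda>\<omega>. cos (U \<omega>))"
  proof (rule integral_indicator_tilt[OF D X _ _ cfX _ B])
    fix t
    have "(CLINT \<omega>|M. iexp (t * X \<omega>) * of_real (cos (U \<omega>)))
        = (CLINT \<omega>|M. (iexp (t * X \<omega> + U \<omega>) + iexp (t * X \<omega> - U \<omega>)) / 2)"
      unfolding cos_eq by (rule Bochner_Integration.integral_cong) (simp_all add: algebra_simps exp_add[symmetric])
    also have "\<dots> = char D t * ((CLINT \<omega>|M. iexp (U \<omega>)) + (CLINT \<omega>|M. iexp (- U \<omega>))) / 2"
      by (simp add: int cf1 cf2 distrib_left del: of_real_add of_real_diff of_real_minus of_real_mult)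
    also have "\<dots> = char D t * (CLINT \<omega>|M. complex_of_real (cos (U \<omega>)))"
      unfolding cos_eq by (simp add: int del: of_real_minus)
    finally show "(CLINT \<omega>|M. iexp (t * X \<omega>) * of_real (cos (U \<omega>))) = char D t * of_real (expectation (\<lambda>\<omega>. cos (U \<omega>)))"
      by simp
  qed auto
  have s: "expectation (\<lambda>\<omega>. indicator B (X \<omega>) * sin (U \<omega>)) = measure D B * expectation (\<lambda>\<omega>. sin (U \<omega>))"
  proof (rule integral_indicator_tilt[OF D X _ _ cfX _ B])
    fix t
    have "(CLINT \<omega>|M. iexp (t * X \<omega>) * of_real (sin (U \<omega>)))
        = (CLINT \<omega>|M. (iexp (t * X \<omega> + U \<omega>) - iexp (t * X \<omega> - U \<omega>)) / (2 * \<i>))"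
      unfolding sin_eq by (rule Bochner_Integration.integral_cong)
        (simp_all add: algebra_simps exp_add[symmetric] diff_divide_distrib)
    also have "\<dots> = char D t * ((CLINT \<omega>|M. iexp (U \<omega>)) - (CLINT \<omega>|M. iexp (- U \<omega>))) / (2 * \<i>)"
      by (simp add: int cf1 cf2 right_diff_distrib del: of_real_add of_real_diff of_real_minus of_real_mult)
    also have "\<dots> = char D t * (CLINT \<omega>|M. complex_of_real (sin (U \<omega>)))"
      unfolding sin_eq by (simp add: int del: of_real_minus)
    finally show "(CLINT \<omega>|M. iexp (t * X \<omega>) * of_real (sin (U \<omega>))) = char D t * of_real (expectation (\<lambda>\<omega>. sin (U \<omega>)))"
      by simp
  qed auto
  have euler: "iexp x = of_real (cos x) + \<i> * of_real (sin x)" for x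
    by (simp add: cis_conv_exp[symmetric] complex_eq_iff)
  have ic: "integrable M (\<lambda>\<omega>. h (X \<omega>) * f (U \<omega>))"
    if "\<And>x. \<bar>f x\<bar> \<le> (1::real)" "\<And>x. \<bar>h x\<bar> \<le> (1::real)"
      and [measurable]: "f \<in> borel_measurable borel" "h \<in> borel_measurable borel" for f h :: "real \<Rightarrow> real"
    using that by (intro integrable_const_bound[of _ 1]) (auto simp: abs_mult mult_le_one)
  have ic1: "integrable M (\<lambda>\<omega>. complex_of_real (indicator B (X \<omega>) * cos (U \<omega>)))"
    "integrable M (\<lambda>\<omega>. complex_of_real (indicator B (X \<omega>) * sin (U \<omega>)))"
    by (intro integrable_of_real ic; simp add: indicator_def)+
  have ic2: "integrable M (\<lambda>\<omega>. complex_of_real (cos (U \<omega>)))" "integrable M (\<lambda>\<omega>. complex_of_real (sin (U \<omega>)))"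
    using ic[of cos "\<lambda>_. 1"] ic[of sin "\<lambda>_. 1"] by (auto intro!: integrable_of_real)
  have "(CLINT \<omega>|M. indicator B (X \<omega>) *\<^sub>R iexp (U \<omega>)) =
    (CLINT \<omega>|M. of_real (indicator B (X \<omega>) * cos (U \<omega>)) + \<i> * of_real (indicator B (X \<omega>) * sin (U \<omega>)))"
    unfolding euler by (simp add: scaleR_conv_of_real algebra_simps)
  also have "\<dots> = of_real (expectation (\<lambda>\<omega>. indicator B (X \<omega>) * cos (U \<omega>))) +
      \<i> * of_real (expectation (\<lambda>\<omega>. indicator B (X \<omega>) * sin (U \<omega>)))"
    using ic1 by (simp del: of_real_mult)
  also have "\<dots> = of_real (measure D B) * (CLINT \<omega>|M. of_real (cos (U \<omega>)) + \<i> * of_real (sin (U \<omega>)))"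
    using ic2 by (simp add: c s distrib_left)
  finally show ?thesis
    unfolding euler .
qed

text \<open>
  Kac's theorem. Only the one-dimensional uniqueness theorem is available, so the coordinates are
  split off one at a time, by conditioning on \<open>X k \<in> B k\<close>.
\<close>

theorem char_factorization_imp_prod_measure:
  fixes X :: "'i \<Rightarrow> 'a \<Rightarrow> real"
  assumes "finite I" and "prob_space M" and D: "\<And>i. i \<in> I \<Longrightarrow> real_distribution (D i)"
    and "\<And>i. i \<in> I \<Longrightarrow> X i \<in> borel_measurable M"
    and "\<And>t. (CLINT \<omega>|M. iexp (\<Sum>i\<in>I. t i * X i \<omega>)) = (\<Prod>i\<in>I. char (D i) (t i))"
    and "\<And>i. i \<in> I \<Longrightarrow> B i \<in> sets borel"
  shows "measure M {\<omega> \<in> space M. \<forall>i\<in>I. X i \<omega> \<in> B i} = (\<Prod>i\<in>I. measure (D i) (B i))"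
  using assms
\<comment> \<open>\<open>M\<close> is generalised because the induction hypothesis will be applied
  to a conditional probability measure.\<close>
proof (induction I arbitrary: M rule: finite_induct)
  case empty
  then show ?case
    by (simp add: prob_space.prob_space)
next
  case (insert k I)
  interpret prob_space M by fact
  have [measurable]: "X k \<in> borel_measurable M" "\<And>i. i \<in> I \<Longrightarrow> X i \<in> borel_measurable M"
    "B k \<in> sets borel" "\<And>i. i \<in> I \<Longrightarrow> B i \<in> sets borel"
    using insert.prems by auto
  have Dk: "real_distribution (D k)" and char0: "\<And>i. i \<in> insert k I \<Longrightarrow> char (D i) 0 = 1"
    using insert.prems real_distribution.char_zero by blast+
  have cf: "(CLINT \<omega>|M. iexp (t * X k \<omega> + (\<Sum>i\<in>I. v i * X i \<omega>))) = char (D k) t * (\<Prod>i\<in>I. char (D i) (v i))" for t v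
  proof -
    have *: "(\<Sum>i\<in>I. (if i = k then t else v i) * X i \<omega>) = (\<Sum>i\<in>I. v i * X i \<omega>)" for \<omega>
      using insert.hyps by (intro sum.cong) auto
    have **: "(\<Prod>i\<in>I. char (D i) (if i = k then t else v i)) = (\<Prod>i\<in>I. char (D i) (v i))"
      using insert.hyps by (intro prod.cong) auto
    show ?thesis
      using insert.prems(4)[of "\<lambda>i. if i = k then t else v i"] insert.hyps by (simp add: * **)
  qed
  have cfI: "(CLINT \<omega>|M. iexp (\<Sum>i\<in>I. v i * X i \<omega>)) = (\<Prod>i\<in>I. char (D i) (v i))" for v
    using cf[of 0 v] char0 by simp
  have key: "(CLINT \<omega>|M. indicator (B k) (X k \<omega>) *\<^sub>R iexp (\<Sum>i\<in>I. v i * X i \<omega>)) =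
      of_real (measure (D k) (B k)) * (\<Prod>i\<in>I. char (D i) (v i))" for v
  proof -
    have "(CLINT \<omega>|M. indicator (B k) (X k \<omega>) *\<^sub>R iexp (\<Sum>i\<in>I. v i * X i \<omega>)) =
      of_real (measure (D k) (B k)) * (CLINT \<omega>|M. iexp (\<Sum>i\<in>I. v i * X i \<omega>))"
    proof (rule indicator_char_factorization[OF Dk])
      fix t s :: real
      show "(CLINT \<omega>|M. iexp (t * X k \<omega> + s * (\<Sum>i\<in>I. v i * X i \<omega>))) =
        char (D k) t * (CLINT \<omega>|M. iexp (s * (\<Sum>i\<in>I. v i * X i \<omega>)))"
        using cf[of t "\<lambda>i. s * v i"] cfI[of "\<lambda>i. s * v i"]
        by (simp add: sum_distrib_left mult.assoc)
    qed measurable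
    then show ?thesis
      by (simp only: cfI)
  qed
  define p where "p = measure (D k) (B k)"
  have p_eq: "expectation (\<lambda>\<omega>. indicator (B k) (X k \<omega>)) = p"
  proof -
    have "complex_of_real (expectation (\<lambda>\<omega>. indicator (B k) (X k \<omega>))) = of_real p"
      using key[of "\<lambda>_. 0"] char0 by (simp add: p_def scaleR_conv_of_real)
    then show ?thesis
      using of_real_eq_iff by blast
  qed
  define A where "A = {\<omega> \<in> space M. X k \<omega> \<in> B k}"
  have [measurable]: "A \<in> sets M"
    unfolding A_def by measurable
  have ind_A: "indicator (B k) (X k \<omega>) = indicator A \<omega>" if "\<omega> \<in> space M" for \<omega>
    using that by (auto simp: A_def indicator_def)
  have A: "measure M A = p"
  proof -
    have "p = expectation (indicator A)"
      unfolding p_eq[symmetric] by (rule Bochner_Integration.integral_cong) (auto simp: ind_A)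
    then show ?thesis
      by simp
  qed
  define C where "C = {\<omega> \<in> space M. \<forall>i\<in>I. X i \<omega> \<in> B i}"
  have [measurable]: "C \<in> sets M"
    unfolding C_def using insert.hyps by measurable
  have set_eq: "{\<omega> \<in> space M. \<forall>i\<in>insert k I. X i \<omega> \<in> B i} = A \<inter> C"
    by (auto simp: A_def C_def)
  show ?case
  \<comment> \<open>Conditioning on a null event is impossible; in that case both sides are
    zero.\<close>
  proof (cases "p = 0")
    case True
    have "measure M (A \<inter> C) \<le> measure M A"
      by (intro finite_measure_mono) auto
    then have "measure M (A \<inter> C) = 0"
      using True A by (simp add: measure_le_0_iff)
    then show ?thesis
      using True insert.hyps by (simp only: set_eq) (simp add: p_def)
  next
    case False
    then have p: "p > 0"
      by (simp add: p_def zero_less_measure_iff)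
    \<comment> \<open>\<open>N\<close> is \<open>M\<close> conditioned on \<open>A\<close>. Dividing
      \<open>key\<close> by \<open>p\<close> shows that the remaining coordinates have the same
      factorised characteristic function under \<open>N\<close> as under \<open>M\<close>.\<close>
    define N where "N = density M (\<lambda>\<omega>. ennreal (indicator A \<omega> / p))"
    have nn: "0 \<le> indicator A \<omega> / p" for \<omega>
      using p by (simp add: indicator_def)
    have N_meas: "emeasure N S = ennreal (measure M (A \<inter> S) / p)" if [measurable]: "S \<in> sets M" for S
    proof -
      have "emeasure N S = (\<integral>\<^sup>+\<omega>. ennreal (1 / p) * indicator (A \<inter> S) \<omega> \<partial>M)"
        unfolding N_def by (subst emeasure_density) (auto intro!: nn_integral_cong simp: indicator_def)
      also have "\<dots> = ennreal (1 / p) * emeasure M (A \<inter> S)"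
        by (rule nn_integral_cmult_indicator) auto
      finally show ?thesis
        using p by (simp add: emeasure_eq_measure ennreal_mult'[symmetric])
    qed
    have A_space: "A \<inter> space M = A"
      by (auto simp: A_def)
    have "prob_space N"
    proof
      show "emeasure N (space N) = 1"
        using N_meas[OF sets.top] p by (simp add: A_space A) (simp add: N_def)
    qed
    have "measure N {\<omega> \<in> space N. \<forall>i\<in>I. X i \<omega> \<in> B i} = (\<Prod>i\<in>I. measure (D i) (B i))"
    proof (rule insert.IH)
      fix t
      have "(CLINT \<omega>|N. iexp (\<Sum>i\<in>I. t i * X i \<omega>)) =
          (CLINT \<omega>|M. (indicator A \<omega> / p) *\<^sub>R iexp (\<Sum>i\<in>I. t i * X i \<omega>))"
        unfolding N_def using nn by (intro integral_density) auto
      also have "\<dots> = (CLINT \<omega>|M. indicator (B k) (X k \<omega>) *\<^sub>R iexp (\<Sum>i\<in>I. t i * X i \<omega>) / of_real p)"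
        by (rule Bochner_Integration.integral_cong) (auto simp: scaleR_conv_of_real ind_A)
      also have "\<dots> = (\<Prod>i\<in>I. char (D i) (t i))"
        using p by (simp add: key p_def[symmetric] del: of_real_sum)
      finally show "(CLINT \<omega>|N. iexp (\<Sum>i\<in>I. t i * X i \<omega>)) = (\<Prod>i\<in>I. char (D i) (t i))" .
    qed (use insert.prems \<open>prob_space N\<close> in \<open>auto simp: N_def\<close>)
    also have "{\<omega> \<in> space N. \<forall>i\<in>I. X i \<omega> \<in> B i} = C"
      by (simp add: C_def N_def)
    finally have "measure M (A \<inter> C) / p = (\<Prod>i\<in>I. measure (D i) (B i))"
      using N_meas[of C] p by (simp add: measure_def)
    then show ?thesis
      using p insert.hyps by (simp only: set_eq) (simp add: p_def[symmetric] field_simps)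
  qed
qed

section \<open>Standard Gaussian vectors\<close>

text \<open>The coordinate-free form covers vectors and pairs of vectors alike, so that a joint law
  can be treated as the law of a single Euclidean vector.\<close>

definition std_gaussian_density :: "'a::euclidean_space \<Rightarrow> real" where
  "std_gaussian_density x = exp (- (norm x)\<^sup>2 / 2) / sqrt (2 * pi) ^ DIM('a)"

lemma std_gaussian_density_pos: "0 < std_gaussian_density x"
  by (simp add: std_gaussian_density_def)

lemma borel_measurable_std_gaussian_density [measurable]: "std_gaussian_density \<in> borel_measurable borel"
  unfolding std_gaussian_density_def[abs_def] by measurable

lemma std_gaussian_density_Pair:
  "std_gaussian_density (x, y) = std_gaussian_density x * std_gaussian_density y"
  by (simp add: std_gaussian_density_def norm_Pair power_add exp_add[symmetric] add_divide_distrib)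

lemma norm_power2_eq_sum: "(norm (x :: 'a::euclidean_space))\<^sup>2 = (\<Sum>b\<in>Basis. (x \<bullet> b)\<^sup>2)"
  unfolding power2_norm_eq_inner by (subst euclidean_inner) (simp add: power2_eq_square)

lemma std_gaussian_density_eq_prod:
  "std_gaussian_density (x :: 'a::euclidean_space) = (\<Prod>b\<in>Basis. std_normal_density (x \<bullet> b))"
proof -
  have "- (norm x)\<^sup>2 / 2 = (\<Sum>b\<in>Basis. - (x \<bullet> b)\<^sup>2 / 2)"
    by (simp add: norm_power2_eq_sum sum_divide_distrib sum_negf)
  then show ?thesis
    by (simp add: std_gaussian_density_def std_normal_density_def exp_sum prod.distrib prod_dividef)
qed

text \<open>Since the squared norm is the sum of the squared coordinates, the given characteristic
  function is a product of one-dimensional standard normal ones. Kac's theorem then yields the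
  probability of every open box, and the boxes form an intersection-stable generator.\<close>

theorem distributed_std_gaussianI:
  fixes V :: "'a \<Rightarrow> 'b::euclidean_space"
  assumes "prob_space M" and V [measurable]: "V \<in> borel_measurable M"
    and cf: "\<And>t. (CLINT \<omega>|M. iexp (t \<bullet> V \<omega>)) = of_real (exp (- (norm t)\<^sup>2 / 2))"
  shows "distributed M lborel V std_gaussian_density"
proof -
  interpret prob_space M by fact
  interpret N: real_distribution std_normal_distribution
    by (rule real_dist_normal_dist)
  have box: "emeasure (distr M lborel V) (box l u) = emeasure (density lborel std_gaussian_density) (box l u)" for l u
  proof -
    let ?B = "\<lambda>b. {l \<bullet> b<..<u \<bullet> b}"
    have "emeasure (distr M lborel V) (box l u) = measure M {\<omega> \<in> space M. \<forall>b\<in>Basis. V \<omega> \<bullet> b \<in> ?B b}"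
      by (simp add: emeasure_distr emeasure_eq_measure)
        (auto intro!: arg_cong[where f = prob] simp: box_def)
    also have "measure M {\<omega> \<in> space M. \<forall>b\<in>Basis. V \<omega> \<bullet> b \<in> ?B b} =
        (\<Prod>b\<in>Basis. measure std_normal_distribution (?B b))"
    proof (rule char_factorization_imp_prod_measure)
      fix t :: "'b \<Rightarrow> real"
      \<comment> \<open>Kac's theorem asks for an arbitrary family of coefficients, the hypothesis
        for a vector; \<open>t'\<close> is the vector with these coefficients as
        coordinates.\<close>
      define t' where "t' = (\<Sum>b\<in>Basis. t b *\<^sub>R b)"
      have *: "(\<Sum>b\<in>Basis. t b * (V \<omega> \<bullet> b)) = t' \<bullet> V \<omega>" for \<omega>
        by (simp add: t'_def inner_sum_left) (simp add: inner_commute)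
      have t': "t' \<bullet> b = t b" if "b \<in> Basis" for b
        using that by (simp add: t'_def)
      have "(\<Prod>b\<in>Basis. char std_normal_distribution (t b)) =
          of_real (\<Prod>b\<in>(Basis :: 'b set). exp (- (t b)\<^sup>2 / 2))"
        by (simp add: char_std_normal_distribution)
      also have "(\<Prod>b\<in>(Basis :: 'b set). exp (- (t b)\<^sup>2 / 2)) = exp (\<Sum>b\<in>(Basis :: 'b set). - (t b)\<^sup>2 / 2)"
        by (simp add: exp_sum)
      also have "(\<Sum>b\<in>(Basis :: 'b set). - (t b)\<^sup>2 / 2) = - (norm t')\<^sup>2 / 2"
        by (simp add: norm_power2_eq_sum sum_divide_distrib sum_negf t')
      finally show "(CLINT \<omega>|M. iexp (\<Sum>b\<in>Basis. t b * (V \<omega> \<bullet> b))) =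
          (\<Prod>b\<in>Basis. char std_normal_distribution (t b))"
        by (simp only: * cf)
    qed (auto intro: real_dist_normal_dist prob_space_axioms)
    also have "ennreal (\<Prod>b\<in>Basis. measure std_normal_distribution (?B b)) =
        (\<Prod>b\<in>Basis. \<integral>\<^sup>+x. ennreal (std_normal_density x * indicator (?B b) x) \<partial>lborel)"
      by (simp add: prod_ennreal[symmetric] N.emeasure_eq_measure[symmetric] emeasure_density ennreal_mult' ennreal_indicator)
    also have "\<dots> = (\<integral>\<^sup>+x. (\<Prod>b\<in>Basis. ennreal (std_normal_density (x \<bullet> b) * indicator (?B b) (x \<bullet> b))) \<partial>lborel)"
      by (rule nn_integral_lborel_prod[symmetric]) auto
    also have "\<dots> = (\<integral>\<^sup>+x. ennreal (std_gaussian_density x) * indicator (box l u) x \<partial>lborel)"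
    proof (rule nn_integral_cong)
      fix x
      have "(\<Prod>b\<in>Basis. indicator (?B b) (x \<bullet> b) :: real) = indicator (box l u) x"
        by (auto simp: indicator_def box_def)
      then have "(\<Prod>b\<in>Basis. std_normal_density (x \<bullet> b) * indicator (?B b) (x \<bullet> b)) =
          std_gaussian_density x * indicator (box l u) x"
        by (simp add: prod.distrib std_gaussian_density_eq_prod)
      moreover have "(\<Prod>b\<in>Basis. ennreal (std_normal_density (x \<bullet> b) * indicator (?B b) (x \<bullet> b))) =
          ennreal (\<Prod>b\<in>Basis. std_normal_density (x \<bullet> b) * indicator (?B b) (x \<bullet> b))"
        by (rule prod_ennreal) auto
      ultimately show "(\<Prod>b\<in>Basis. ennreal (std_normal_density (x \<bullet> b) * indicator (?B b) (x \<bullet> b))) =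
          ennreal (std_gaussian_density x) * indicator (box l u) x"
        by (simp only: ennreal_mult'' indicator_pos_le ennreal_indicator)
    qed
    finally show ?thesis
      by (simp add: emeasure_density)
  qed
  have "distr M lborel V = density lborel std_gaussian_density"
  proof (rule measure_eqI_generator_eq)
    let ?E = "range (\<lambda>(a, b). box a b :: 'b set)"
    show "Int_stable ?E"
      by (auto simp: Int_stable_def box_Int_box)
    show "?E \<subseteq> Pow UNIV" "sets (distr M lborel V) = sigma_sets UNIV ?E"
        "sets (density lborel std_gaussian_density) = sigma_sets UNIV ?E"
      by (simp_all add: borel_eq_box)
    \<comment> \<open>Agreement on a generator determines the measure only along an exhausting
      sequence of sets of finite mass; the growing cubes supply one.\<close>
    let ?A = "\<lambda>n::nat. box (- (real n *\<^sub>R One)) (real n *\<^sub>R One) :: 'b set"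
    show "range ?A \<subseteq> ?E" "(\<Union>i. ?A i) = UNIV"
      unfolding UN_box_eq_UNIV by auto
    show "emeasure (distr M lborel V) (?A i) \<noteq> \<infinity>" for i
      by (simp add: emeasure_distr)
    show "emeasure (distr M lborel V) X = emeasure (density lborel std_gaussian_density) X" if "X \<in> ?E" for X
      using that box by auto
  qed
  then show ?thesis
    by (simp add: distributed_def)
qed

text \<open>Centring by the mean gives one formula for both kinds of Gaussian variable: a point mass
  has variance 0 and characteristic function 1. Finite second moments are obtained along the way and
  justify all later covariance computations.\<close>

lemma gaussian_real_char:
  assumes "prob_space M" and G: "gaussian_real M X"
  shows "(CLINT \<omega>|M. iexp (X \<omega> - prob_space.expectation M X)) = of_real (exp (- prob_space.variance M X / 2))"
    and "integrable M (\<lambda>\<omega>. (X \<omega>)\<^sup>2)"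
proof -
  interpret prob_space M by fact
  have X [measurable]: "X \<in> borel_measurable M"
    using G by (simp add: gaussian_real_def)
  consider (normal) \<mu> \<sigma> where "\<sigma> > 0" "distributed M lborel X (normal_density \<mu> \<sigma>)"
    | (const) \<mu> where "AE \<omega> in M. X \<omega> = \<mu>"
    using G by (auto simp: gaussian_real_def)
  then have "(CLINT \<omega>|M. iexp (X \<omega> - prob_space.expectation M X)) = of_real (exp (- prob_space.variance M X / 2))
    \<and> integrable M (\<lambda>\<omega>. (X \<omega>)\<^sup>2)"
  proof cases
    case normal
    note mean = normal_distributed_expectation[OF normal] and var = normal_distributed_variance[OF normal]
    have S: "distributed M lborel (\<lambda>\<omega>. (X \<omega> - \<mu>) / \<sigma>) std_normal_density"
      using normal normal_standard_normal_convert by blast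
    have "(CLINT \<omega>|M. iexp (X \<omega> - \<mu>)) = (CLINT \<omega>|M. iexp (\<sigma> * ((X \<omega> - \<mu>) / \<sigma>)))"
      using normal by simp
    also have "\<dots> = char (distr M lborel (\<lambda>\<omega>. (X \<omega> - \<mu>) / \<sigma>)) \<sigma>"
      unfolding char_def by (subst integral_distr) auto
    also have "\<dots> = of_real (exp (- \<sigma>\<^sup>2 / 2))"
      using char_std_normal_distribution by (simp add: distributed_distr_eq_density[OF S])
    finally have 1: "(CLINT \<omega>|M. iexp (X \<omega> - \<mu>)) = of_real (exp (- \<sigma>\<^sup>2 / 2))" .
    have "integrable lborel (\<lambda>x. normal_density \<mu> \<sigma> x * x\<^sup>2)"
    proof -
      \<comment> \<open>The expansion of \<open>x\<^sup>2\<close> around \<open>\<mu>\<close>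
        reduces the second moment to the central second moment, the mean and the total mass.\<close>
      have "integrable lborel (\<lambda>x. normal_density \<mu> \<sigma> x * (x - \<mu>)\<^sup>2 + 2 * \<mu> * (normal_density \<mu> \<sigma> x * x) - \<mu>\<^sup>2 * normal_density \<mu> \<sigma> x)"
        by (intro Bochner_Integration.integrable_add Bochner_Integration.integrable_diff integrable_mult_right
              integrable_normal_moment integrable_normal_moment_nz_1 integrable_normal_density normal)
      then show ?thesis
        by (simp add: algebra_simps power2_eq_square)
    qed
    then have "integrable M (\<lambda>\<omega>. (X \<omega>)\<^sup>2)"
      using distributed_integrable[OF normal(2), of "\<lambda>x. x\<^sup>2"] by simp
    with 1 var show ?thesis
      unfolding mean by simp
  next
    case const
    have mean: "expectation X = \<mu>"
      using integral_cong_AE[of X M "\<lambda>_. \<mu>"] const by (simp add: prob_space)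
    have var: "variance X = 0"
      using integral_cong_AE[of "\<lambda>\<omega>. (X \<omega> - \<mu>)\<^sup>2" M "\<lambda>_. 0"] const by (simp add: mean)
    have "(CLINT \<omega>|M. iexp (X \<omega> - \<mu>)) = (CLINT \<omega>|M. 1)"
      using const by (intro integral_cong_AE) auto
    moreover have "AE \<omega> in M. (X \<omega>)\<^sup>2 = \<mu>\<^sup>2"
      using const by eventually_elim simp
    then have "integrable M (\<lambda>\<omega>. (X \<omega>)\<^sup>2)"
      using const integrable_cong_AE[of "\<lambda>\<omega>. (X \<omega>)\<^sup>2" M "\<lambda>_. \<mu>\<^sup>2"] by simp
    ultimately show ?thesis
      using var unfolding mean by (simp add: prob_space)
  qed
  then show "(CLINT \<omega>|M. iexp (X \<omega> - prob_space.expectation M X)) = of_real (exp (- prob_space.variance M X / 2))"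
    and "integrable M (\<lambda>\<omega>. (X \<omega>)\<^sup>2)"
    by auto
qed

section \<open>Linear changes of variables and conditional entropy\<close>

lemma
  fixes A :: "'a::semiring_1 ^ 'n ^ 'm"
  assumes "invertible A"
  shows matrix_inv_left: "matrix_inv A ** A = mat 1" and matrix_inv_right: "A ** matrix_inv A = mat 1"
  using someI_ex[OF assms[unfolded invertible_def]] by (auto simp: matrix_inv_def)

lemma borel_measurable_matrix_vector_mult [measurable]:
  fixes A :: "real ^ 'n::finite ^ 'm::finite"
  shows "(\<lambda>x. A *v x) \<in> borel_measurable borel"
  by (intro borel_measurable_continuous_onI continuous_intros)

text \<open>
  The library's change of variables is restricted to well-ordered index types; for arbitrary finite
  ones the determinant formula is obtained from elementary matrices.
\<close>

lemma nn_integral_lborel_shear: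
  fixes m :: "'a::euclidean_space" and f :: "'a \<Rightarrow> ennreal"
  assumes m: "m \<in> Basis" and f [measurable]: "f \<in> borel_measurable borel"
    and s [measurable]: "s \<in> borel_measurable borel"
    and s_indep: "\<And>x y. s (x + y *\<^sub>R m) = (s x :: real)"
  shows "(\<integral>\<^sup>+x. f (x + s x *\<^sub>R m) \<partial>lborel) = (\<integral>\<^sup>+x. f x \<partial>lborel)"
proof -
  interpret product_sigma_finite "\<lambda>_::'a. lborel :: real measure"
    by standard
  define I where "I = Basis - {m}"
  have I: "finite I" "m \<notin> I" and Basis: "Basis = insert m I"
    using m by (auto simp: I_def)
  have split: "(\<integral>\<^sup>+x. h x \<partial>lborel) =
      (\<integral>\<^sup>+g. \<integral>\<^sup>+y. h ((\<Sum>b\<in>I. g b *\<^sub>R b) + y *\<^sub>R m) \<partial>lborel \<partial>Pi\<^sub>M I (\<lambda>_. lborel))"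
    if [measurable]: "h \<in> borel_measurable borel" for h :: "'a \<Rightarrow> ennreal"
  proof -
    have "(\<integral>\<^sup>+x. h x \<partial>lborel) = (\<integral>\<^sup>+g. h (\<Sum>b\<in>Basis. g b *\<^sub>R b) \<partial>Pi\<^sub>M Basis (\<lambda>_. lborel))"
      by (subst lborel_eq) (simp add: nn_integral_distr)
    also have "\<dots> = (\<integral>\<^sup>+g. \<integral>\<^sup>+y. h (\<Sum>b\<in>insert m I. (g(m := y)) b *\<^sub>R b) \<partial>lborel \<partial>Pi\<^sub>M I (\<lambda>_. lborel))"
      unfolding Basis by (rule product_nn_integral_insert[OF I]) measurable
    also have "\<dots> = (\<integral>\<^sup>+g. \<integral>\<^sup>+y. h ((\<Sum>b\<in>I. g b *\<^sub>R b) + y *\<^sub>R m) \<partial>lborel \<partial>Pi\<^sub>M I (\<lambda>_. lborel))"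
    proof (intro nn_integral_cong arg_cong[where f = h])
      fix g :: "'a \<Rightarrow> real" and y :: real
      have "(\<Sum>b\<in>I. (g(m := y)) b *\<^sub>R b) = (\<Sum>b\<in>I. g b *\<^sub>R b)"
        using I by (intro sum.cong) auto
      then show "(\<Sum>b\<in>insert m I. (g(m := y)) b *\<^sub>R b) = (\<Sum>b\<in>I. g b *\<^sub>R b) + y *\<^sub>R m"
        using I by (simp add: add.commute)
    qed
    finally show ?thesis .
  qed
  \<comment> \<open>With the other coordinates fixed, \<open>s\<close> is constant in
    \<open>y\<close>, so the shear is a translation in \<open>y\<close> alone. The factor
    \<open>1 * y\<close> is there to match the affine substitution rule on the real line.\<close>
  have "(\<integral>\<^sup>+x. f (x + s x *\<^sub>R m) \<partial>lborel) =
      (\<integral>\<^sup>+g. \<integral>\<^sup>+y. f ((\<Sum>b\<in>I. g b *\<^sub>R b) + (s (\<Sum>b\<in>I. g b *\<^sub>R b) + 1 * y) *\<^sub>R m) \<partial>lborel \<partial>Pi\<^sub>M I (\<lambda>_. lborel))"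
    by (subst split, measurable) (simp only: s_indep, simp add: algebra_simps)
  also have "\<dots> = (\<integral>\<^sup>+g. \<integral>\<^sup>+y. f ((\<Sum>b\<in>I. g b *\<^sub>R b) + y *\<^sub>R m) \<partial>lborel \<partial>Pi\<^sub>M I (\<lambda>_. lborel))"
  proof (rule nn_integral_cong)
    fix g
    show "(\<integral>\<^sup>+y. f ((\<Sum>b\<in>I. g b *\<^sub>R b) + (s (\<Sum>b\<in>I. g b *\<^sub>R b) + 1 * y) *\<^sub>R m) \<partial>lborel) =
        (\<integral>\<^sup>+y. f ((\<Sum>b\<in>I. g b *\<^sub>R b) + y *\<^sub>R m) \<partial>lborel)"
      using nn_integral_real_affine[of "\<lambda>y. f ((\<Sum>b\<in>I. g b *\<^sub>R b) + y *\<^sub>R m)" 1 "s (\<Sum>b\<in>I. g b *\<^sub>R b)"]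
      by simp
  qed
  also have "\<dots> = (\<integral>\<^sup>+x. f x \<partial>lborel)"
    by (rule split[symmetric]) measurable
  finally show ?thesis .
qed

lemma nn_integral_lborel_diagonal_matrix:
  fixes A :: "real ^ 'n ^ 'n::finite"
  assumes A: "\<And>i j. i \<noteq> j \<Longrightarrow> A $ i $ j = 0" and inv: "invertible A"
    and f [measurable]: "f \<in> borel_measurable borel"
  shows "(\<integral>\<^sup>+x. f x \<partial>lborel) = ennreal \<bar>det A\<bar> * (\<integral>\<^sup>+x. f (A *v x) \<partial>lborel)"
proof -
  have Basis: "(Basis :: (real ^ 'n) set) = range (\<lambda>i. axis i 1)"
    by (auto simp: Basis_vec_def)
  have inj: "inj (\<lambda>i. axis i 1 :: real ^ 'n)"
    by (auto simp: inj_on_def axis_eq_axis)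
  \<comment> \<open>The scaling factors of \<open>lborel_affine_euclidean\<close> are indexed by
    basis vectors, not by coordinates; \<open>c\<close> recovers the diagonal entry from the basis
    vector.\<close>
  define c :: "real ^ 'n \<Rightarrow> real" where "c b = (\<Sum>i\<in>UNIV. b $ i * A $ i $ i)" for b
  have c: "c (axis i 1) = A $ i $ i" for i
  proof -
    have "c (axis i 1) = (\<Sum>j\<in>UNIV. if j = i then A $ j $ j else 0)"
      unfolding c_def by (rule sum.cong) (auto simp: axis_def)
    then show ?thesis
      by simp
  qed
  have det: "det A = (\<Prod>i\<in>UNIV. A $ i $ i)"
    by (rule det_diagonal) (rule A)
  have nz: "A $ i $ i \<noteq> 0" for i
    using inv unfolding invertible_det_nz det by auto
  have prod: "(\<Prod>j\<in>Basis. \<bar>c j\<bar>) = \<bar>det A\<bar>"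
    unfolding Basis det by (simp add: prod.reindex[OF inj] c abs_prod)
  have map: "0 + (\<Sum>j\<in>Basis. (c j * (x \<bullet> j)) *\<^sub>R j) = A *v x" for x
  proof (rule vec_eq_iff[THEN iffD2], rule allI)
    fix i
    have "(\<Sum>j\<in>UNIV. A $ i $ j * x $ j) = (\<Sum>j\<in>UNIV. if j = i then A $ i $ i * x $ i else 0)"
      using A by (intro sum.cong) auto
    moreover have "(\<Sum>j\<in>Basis. (c j * (x \<bullet> j)) *\<^sub>R j) $ i =
        (\<Sum>k\<in>UNIV. (c (axis k 1) * (x \<bullet> axis k 1)) * (axis k 1 :: real ^ 'n) $ i)"
      unfolding Basis by (simp add: sum.reindex[OF inj])
    moreover have "\<dots> = (\<Sum>k\<in>UNIV. if k = i then A $ i $ i * x $ i else 0)"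
      by (rule sum.cong) (auto simp: c inner_axis, auto simp: axis_def)
    ultimately show "(0 + (\<Sum>j\<in>Basis. (c j * (x \<bullet> j)) *\<^sub>R j)) $ i = (A *v x) $ i"
      by (simp add: matrix_vector_mult_def)
  qed
  have nzc: "c j \<noteq> 0" if "j \<in> Basis" for j
    using that nz c unfolding Basis by auto
  have "lborel = density (distr lborel borel (\<lambda>x. A *v x)) (\<lambda>_. ennreal \<bar>det A\<bar>)"
    using lborel_affine_euclidean[of c 0, OF nzc] by (simp only: map prod)
  then have "(\<integral>\<^sup>+x. f x \<partial>lborel) = (\<integral>\<^sup>+x. f x \<partial>density (distr lborel borel (\<lambda>x. A *v x)) (\<lambda>_. ennreal \<bar>det A\<bar>))"
    by (rule arg_cong[where f = "\<lambda>N. integral\<^sup>N N f"])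
  then show ?thesis
    by (simp add: nn_integral_density nn_integral_distr nn_integral_cmult)
qed

text \<open>A transposition is its own inverse, so the preimage of a box is the box with
  correspondingly exchanged corners. Its volume is the same product with two factors exchanged, and
  Lebesgue measure is determined by volumes of boxes.\<close>

lemma nn_integral_lborel_swap:
  fixes m n :: "'n::finite" and f :: "real ^ 'n \<Rightarrow> ennreal"
  assumes f [measurable]: "f \<in> borel_measurable borel"
  shows "(\<integral>\<^sup>+x. f (\<chi> i. x $ Transposition.transpose m n i) \<partial>lborel) = (\<integral>\<^sup>+x. f x \<partial>lborel)"
proof -
  let ?p = "Transposition.transpose m n"
  let ?S = "\<lambda>x :: real ^ 'n. \<chi> i. x $ ?p i"
  have [measurable]: "?S \<in> borel_measurable borel"
    by (intro borel_measurable_continuous_onI continuous_intros)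
  have Basis: "(Basis :: (real ^ 'n) set) = range (\<lambda>i. axis i 1)"
    by (auto simp: Basis_vec_def)
  have inj: "inj (\<lambda>i. axis i 1 :: real ^ 'n)"
    by (auto simp: inj_on_def axis_eq_axis)
  have vol: "emeasure lborel (box l u) = (\<Prod>i\<in>UNIV. u $ i - l $ i)" if "\<And>i. l $ i \<le> u $ i" for l u :: "real ^ 'n"
    using that unfolding emeasure_lborel_box_eq Basis
    by (simp add: prod.reindex[OF inj] inner_axis prod_ennreal)
  have "lborel = distr lborel borel ?S"
  proof (rule lborel_eqI)
    fix l u :: "real ^ 'n"
    assume "\<And>b. b \<in> Basis \<Longrightarrow> l \<bullet> b \<le> u \<bullet> b"
    then have le: "l $ i \<le> u $ i" for i
      unfolding Basis by (metis rangeI cart_eq_inner_axis)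
    have pre: "?S -` box l u = box (?S l) (?S u)"
    proof (intro set_eqI iffI)
      fix x assume "x \<in> ?S -` box l u"
      then have *: "l $ j < x $ ?p j \<and> x $ ?p j < u $ j" for j
        by (simp add: mem_box_cart)
      have "l $ ?p i < x $ i \<and> x $ i < u $ ?p i" for i
        using *[of "?p i"] by simp
      then show "x \<in> box (?S l) (?S u)"
        by (simp add: mem_box_cart)
    next
      fix x assume "x \<in> box (?S l) (?S u)"
      then have *: "l $ ?p j < x $ j \<and> x $ j < u $ ?p j" for j
        by (simp add: mem_box_cart)
      have "l $ i < x $ ?p i \<and> x $ ?p i < u $ i" for i
        using *[of "?p i"] by simp
      then show "x \<in> ?S -` box l u"
        by (simp add: mem_box_cart)
    qed
    have "emeasure (distr lborel borel ?S) (box l u) = emeasure lborel (box (?S l) (?S u))"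
      by (simp add: emeasure_distr pre)
    also have "\<dots> = (\<Prod>i\<in>UNIV. u $ ?p i - l $ ?p i)"
      using le by (subst vol) auto
    also have "\<dots> = (\<Prod>i\<in>UNIV. u $ i - l $ i)"
      using prod.reindex_bij_betw[OF permutes_bij[OF permutes_swap_id[of m UNIV n]], of "\<lambda>i. u $ i - l $ i"] by simp
    also have "\<dots> = emeasure lborel (box l u)"
      using le by (subst vol) auto
    also have "\<dots> = (\<Prod>b\<in>Basis. (u - l) \<bullet> b)"
      using \<open>\<And>b. b \<in> Basis \<Longrightarrow> l \<bullet> b \<le> u \<bullet> b\<close> by (simp add: emeasure_lborel_box_eq)
    finally show "emeasure (distr lborel borel ?S) (box l u) = (\<Prod>b\<in>Basis. (u - l) \<bullet> b)" .
  qed simp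
  then have "(\<integral>\<^sup>+x. f x \<partial>lborel) = (\<integral>\<^sup>+x. f x \<partial>distr lborel borel ?S)"
    by (rule arg_cong[where f = "\<lambda>N. integral\<^sup>N N f"])
  then show ?thesis
    by (simp add: nn_integral_distr)
qed

text \<open>The formula is multiplicative in \<open>A\<close>, so elementary matrices suffice: a
  matrix with a zero row contradicts invertibility, a diagonal one scales the axes, and swaps and
  shears have determinant of absolute value 1 and preserve the integral.\<close>

lemma nn_integral_lborel_matrix:
  fixes A :: "real ^ 'n ^ 'n::finite"
  assumes "invertible A" and "f \<in> borel_measurable borel"
  shows "(\<integral>\<^sup>+x. f x \<partial>lborel) = ennreal \<bar>det A\<bar> * (\<integral>\<^sup>+x. f (A *v x) \<partial>lborel)"
  using assms
\<comment> \<open>In the product case the second factor acts on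
  \<open>\<lambda>x. f (A *v x)\<close> instead of \<open>f\<close>, hence the
  generalisation.\<close>
proof (induction A arbitrary: f rule: induct_matrix_elementary)
  case (1 A B)
  note [measurable] = "1.prems"(2)
  have inv: "invertible A" "invertible B"
    using "1.prems"(1) by (auto simp: invertible_det_nz det_mul)
  have "(\<integral>\<^sup>+x. f x \<partial>lborel) = ennreal \<bar>det A\<bar> * (\<integral>\<^sup>+x. f (A *v x) \<partial>lborel)"
    by (rule "1.IH"(1)[OF inv(1)]) measurable
  also have "(\<integral>\<^sup>+x. f (A *v x) \<partial>lborel) = ennreal \<bar>det B\<bar> * (\<integral>\<^sup>+x. f (A *v (B *v x)) \<partial>lborel)"
    by (rule "1.IH"(2)[OF inv(2)]) measurable
  finally show ?case
    by (simp add: det_mul abs_mult ennreal_mult mult.assoc matrix_vector_mul_assoc)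
next
  case (2 A i)
  then have "det A = 0"
    using det_zero_row by blast
  then show ?case
    using "2.prems" by (simp add: invertible_det_nz)
next
  case (3 A)
  then show ?case
    by (intro nn_integral_lborel_diagonal_matrix) auto
next
  case (4 m n)
  let ?A = "\<chi> i j. mat 1 $ i $ Transposition.transpose m n j :: real ^ 'n ^ 'n"
  have "\<bar>det ?A\<bar> = 1"
    using det_permute_columns[of "Transposition.transpose m n" "mat 1 :: real ^ 'n ^ 'n"]
    by (simp add: sign_swap_id permutes_swap_id)
  moreover have "?A *v x = (\<chi> i. x $ Transposition.transpose m n i)" for x
  proof (rule vec_eq_iff[THEN iffD2], rule allI)
    fix i
    have "(?A *v x) $ i = (\<Sum>j\<in>UNIV. if j = Transposition.transpose m n i then x $ j else 0)"
      unfolding matrix_vector_mult_def vec_lambda_beta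
      by (rule sum.cong) (auto simp: mat_def)
    then show "(?A *v x) $ i = (\<chi> i. x $ Transposition.transpose m n i) $ i"
      by simp
  qed
  ultimately show ?case
    using "4.prems" by (simp add: nn_integral_lborel_swap)
next
  case (5 m n c)
  let ?A = "\<chi> i j. if i = m \<and> j = n then c else of_bool (i = j) :: real ^ 'n ^ 'n"
  have "?A = (\<chi> k. if k = m then row m (mat 1) + c *s row n (mat 1) else row k (mat 1))"
    using 5(1) by (auto simp: vec_eq_iff row_def mat_def)
  then have "det ?A = 1"
    using det_row_operation[OF 5(1), of "mat 1" c] by simp
  moreover have "?A *v x = x + (c * x $ n) *\<^sub>R axis m 1" for x
  proof (rule vec_eq_iff[THEN iffD2], rule allI)
    fix i
    have "(?A *v x) $ i = (\<Sum>j\<in>UNIV. (if j = i then x $ i else 0) + (if j = n then of_bool (i = m) * c * x $ n else 0))"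
      unfolding matrix_vector_mult_def vec_lambda_beta
      using 5(1) by (intro sum.cong) auto
    then show "(?A *v x) $ i = (x + (c * x $ n) *\<^sub>R axis m 1) $ i"
      by (simp add: sum.distrib axis_def)
  qed
  moreover have "axis m 1 \<in> (Basis :: (real ^ 'n) set)"
    by (simp add: axis_in_Basis_iff)
  \<comment> \<open>Because \<open>m\<close> and \<open>n\<close> differ, moving along
    \<open>axis m 1\<close> does not alter \<open>c * x $ n\<close>, which is the invariance that
    the shear lemma demands.\<close>
  then have "(\<integral>\<^sup>+x. f (x + (c * x $ n) *\<^sub>R axis m 1) \<partial>lborel) = (\<integral>\<^sup>+x. f x \<partial>lborel)"
    using 5 by (intro nn_integral_lborel_shear) (auto simp: axis_def
        intro!: borel_measurable_continuous_onI continuous_intros)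
  ultimately show ?case
    by simp
qed

lemma nn_integral_matrix_affine:
  fixes T :: "real ^ 'n ^ 'n::finite"
  assumes T: "invertible T" and f [measurable]: "f \<in> borel_measurable borel"
  shows "(\<integral>\<^sup>+x. f x \<partial>lborel) = ennreal \<bar>det T\<bar> * (\<integral>\<^sup>+x. f (a + T *v x) \<partial>lborel)"
proof -
  have "(\<integral>\<^sup>+x. f x \<partial>lborel) = (\<integral>\<^sup>+x. f (a + x) \<partial>lborel)"
    by (subst lborel_distr_plus[of a, symmetric]) (simp add: nn_integral_distr)
  also have "\<dots> = ennreal \<bar>det T\<bar> * (\<integral>\<^sup>+x. f (a + T *v x) \<partial>lborel)"
    by (rule nn_integral_lborel_matrix[OF T]) measurable
  finally show ?thesis .
qed

section \<open>Densities under affine maps, and the entropy they determine\<close>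

lemma distributed_matrix_affine:
  fixes T :: "real ^ 'n ^ 'n::finite" and q :: "real ^ 'n \<Rightarrow> real"
  assumes T: "invertible T" and N: "distributed M lborel N q"
    and q [measurable]: "q \<in> borel_measurable borel"
  shows "distributed M lborel (\<lambda>\<omega>. a + T *v N \<omega>) (\<lambda>x. q (matrix_inv T *v (x - a)) / \<bar>det T\<bar>)"
proof -
  note [measurable] = measurable_compose[OF _ borel_measurable_matrix_vector_mult]
  have [measurable]: "N \<in> borel_measurable M"
    using distributed_measurable[OF N] by simp
  have inv: "matrix_inv T *v (T *v x) = x" for x
    using T by (simp_all add: matrix_vector_mul_assoc matrix_inv_left)
  have det: "det T \<noteq> 0"
    using T by (simp add: invertible_det_nz)
  have "distr M lborel (\<lambda>\<omega>. a + T *v N \<omega>) = density lborel (\<lambda>x. ennreal (q (matrix_inv T *v (x - a)) / \<bar>det T\<bar>))"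
  proof (rule measure_eqI)
    fix A assume "A \<in> sets (distr M lborel (\<lambda>\<omega>. a + T *v N \<omega>))"
    then have [measurable]: "A \<in> sets borel"
      by simp
    have "emeasure (distr M lborel (\<lambda>\<omega>. a + T *v N \<omega>)) A = (\<integral>\<^sup>+\<omega>. indicator A (a + T *v N \<omega>) \<partial>M)"
      by (subst emeasure_distr) (auto simp: nn_integral_indicator[symmetric] simp del: nn_integral_indicator
          intro!: nn_integral_cong split: split_indicator)
    also have "\<dots> = (\<integral>\<^sup>+x. ennreal (q x) * indicator A (a + T *v x) \<partial>lborel)"
      by (rule distributed_nn_integral[OF N, symmetric]) measurable
    \<comment> \<open>Splitting off \<open>\<bar>det T\<bar>\<close> produces the right-hand side of
      the change of variables, which is then read backwards.\<close>
    also have "\<dots> = ennreal \<bar>det T\<bar> * (\<integral>\<^sup>+x. ennreal (q x / \<bar>det T\<bar>) * indicator A (a + T *v x) \<partial>lborel)"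
      using det by (subst nn_integral_cmult[symmetric])
        (auto intro!: nn_integral_cong simp: ennreal_mult'[symmetric] split: split_indicator)
    also have "\<dots> = (\<integral>\<^sup>+x. ennreal (q (matrix_inv T *v (x - a)) / \<bar>det T\<bar>) * indicator A x \<partial>lborel)"
      by (subst nn_integral_matrix_affine[OF T, of _ a]) (simp_all add: inv)
    finally show "emeasure (distr M lborel (\<lambda>\<omega>. a + T *v N \<omega>)) A =
        emeasure (density lborel (\<lambda>x. ennreal (q (matrix_inv T *v (x - a)) / \<bar>det T\<bar>))) A"
      by (simp add: emeasure_density)
  qed simp
  then show ?thesis
    by (simp add: distributed_def)
qed

text \<open>For fixed \<open>y\<close> the map \<open>n \<mapsto> h y + T *v n\<close> is affine
  with a determinant that does not depend on \<open>y\<close>, so the change of variables can be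
  made inside a Fubini integral. Since \<open>h\<close> acts only as a translation on each fibre, it
  may be any Borel function and does not enter the Jacobian.\<close>

lemma distributed_fibre_affine:
  fixes T :: "real ^ 'n ^ 'n::finite" and N :: "'a \<Rightarrow> real ^ 'n" and Y :: "'a \<Rightarrow> 'b::euclidean_space"
    and f :: "(real ^ 'n) \<times> 'b \<Rightarrow> real"
  assumes T: "invertible T" and NY: "distributed M (lborel \<Otimes>\<^sub>M lborel) (\<lambda>\<omega>. (N \<omega>, Y \<omega>)) f"
    and f [measurable]: "f \<in> borel_measurable borel" and h [measurable]: "h \<in> borel_measurable borel"
  shows "distributed M (lborel \<Otimes>\<^sub>M lborel) (\<lambda>\<omega>. (h (Y \<omega>) + T *v N \<omega>, Y \<omega>))
    (\<lambda>(w, y). f (matrix_inv T *v (w - h y), y) / \<bar>det T\<bar>)"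
proof -
  note [measurable] = measurable_compose[OF _ borel_measurable_matrix_vector_mult]
  have [measurable]: "(\<lambda>\<omega>. (N \<omega>, Y \<omega>)) \<in> borel_measurable M"
    using distributed_measurable[OF NY] by (simp add: lborel_prod)
  have [measurable]: "N \<in> borel_measurable M" "Y \<in> borel_measurable M"
    using measurable_compose[OF \<open>(\<lambda>\<omega>. (N \<omega>, Y \<omega>)) \<in> borel_measurable M\<close>, of fst]
      measurable_compose[OF \<open>(\<lambda>\<omega>. (N \<omega>, Y \<omega>)) \<in> borel_measurable M\<close>, of snd]
    by (auto simp: borel_prod[symmetric])
  have [measurable]: "f \<in> borel_measurable (borel \<Otimes>\<^sub>M borel)"
    by (simp add: borel_prod)
  have inv: "matrix_inv T *v (T *v x) = x" for x
    using T by (simp_all add: matrix_vector_mul_assoc matrix_inv_left)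
  have det: "det T \<noteq> 0"
    using T by (simp add: invertible_det_nz)
  let ?f = "\<lambda>(w, y). f (matrix_inv T *v (w - h y), y) / \<bar>det T\<bar>"
  let ?V = "\<lambda>\<omega>. (h (Y \<omega>) + T *v N \<omega>, Y \<omega>)"
  have "distr M (lborel \<Otimes>\<^sub>M lborel) ?V = density (lborel \<Otimes>\<^sub>M lborel) (\<lambda>x. ennreal (?f x))"
  proof (rule measure_eqI)
    fix A assume "A \<in> sets (distr M (lborel \<Otimes>\<^sub>M lborel) ?V)"
    then have [measurable]: "A \<in> sets (borel \<Otimes>\<^sub>M borel)"
      by simp
    have "emeasure (distr M (lborel \<Otimes>\<^sub>M lborel) ?V) A = (\<integral>\<^sup>+\<omega>. indicator A (?V \<omega>) \<partial>M)"
      by (subst emeasure_distr) (auto simp: nn_integral_indicator[symmetric] simp del: nn_integral_indicator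
          intro!: nn_integral_cong split: split_indicator)
    also have "\<dots> = (\<integral>\<^sup>+\<omega>. (\<lambda>(n, y). indicator A (h y + T *v n, y)) (N \<omega>, Y \<omega>) \<partial>M)"
      by simp
    also have "\<dots> = (\<integral>\<^sup>+x. ennreal (f x) * (\<lambda>(n, y). indicator A (h y + T *v n, y)) x \<partial>(lborel \<Otimes>\<^sub>M lborel))"
      by (rule distributed_nn_integral[OF NY, symmetric]) measurable
    \<comment> \<open>The second component becomes the outer variable, so that the inner integral
      runs over one fibre.\<close>
    also have "\<dots> = (\<integral>\<^sup>+y. \<integral>\<^sup>+n. ennreal (f (n, y)) * indicator A (h y + T *v n, y) \<partial>lborel \<partial>lborel)"
      by (subst lborel_pair.nn_integral_snd[symmetric]) (auto simp: split_beta')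
    also have "\<dots> = (\<integral>\<^sup>+y. \<integral>\<^sup>+w. ennreal (?f (w, y)) * indicator A (w, y) \<partial>lborel \<partial>lborel)"
    proof (rule nn_integral_cong)
      fix y :: 'b
      have "(\<integral>\<^sup>+n. ennreal (f (n, y)) * indicator A (h y + T *v n, y) \<partial>lborel) =
        ennreal \<bar>det T\<bar> * (\<integral>\<^sup>+n. ennreal (f (n, y) / \<bar>det T\<bar>) * indicator A (h y + T *v n, y) \<partial>lborel)"
        using det by (subst nn_integral_cmult[symmetric])
          (auto intro!: nn_integral_cong simp: ennreal_mult'[symmetric] split: split_indicator)
      also have "\<dots> = (\<integral>\<^sup>+w. ennreal (?f (w, y)) * indicator A (w, y) \<partial>lborel)"
        by (subst nn_integral_matrix_affine[OF T, of _ "h y"]) (simp_all add: inv)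
      finally show "(\<integral>\<^sup>+n. ennreal (f (n, y)) * indicator A (h y + T *v n, y) \<partial>lborel) =
        (\<integral>\<^sup>+w. ennreal (?f (w, y)) * indicator A (w, y) \<partial>lborel)" .
    qed
    also have "\<dots> = (\<integral>\<^sup>+x. ennreal (?f x) * indicator A x \<partial>(lborel \<Otimes>\<^sub>M lborel))"
      by (subst lborel_pair.nn_integral_snd[symmetric]) (auto simp: split_beta')
    finally show "emeasure (distr M (lborel \<Otimes>\<^sub>M lborel) ?V) A =
        emeasure (density (lborel \<Otimes>\<^sub>M lborel) (\<lambda>x. ennreal (?f x))) A"
      by (subst emeasure_density) auto
  qed simp
  then show ?thesis
    by (simp add: distributed_def split_beta')
qed

text \<open>The conditional density of \<open>W\<close> given \<open>Y\<close>, evaluated at the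
  random point itself, is \<open>q (N \<omega>) / \<bar>det T\<bar>\<close>: the translation by
  \<open>h\<close> is undone and the factor \<open>p\<close> cancels. The conditional entropy is
  minus the expected logarithm of this quotient, and positivity of the densities lets the logarithm
  be split.\<close>

lemma (in information_space) conditional_entropy_affine_noise:
  fixes T :: "real ^ 'n ^ 'n::finite" and N W :: "'a \<Rightarrow> real ^ 'n" and Y :: "'a \<Rightarrow> 'b::euclidean_space"
    and q :: "real ^ 'n \<Rightarrow> real" and p :: "'b \<Rightarrow> real"
  assumes T: "invertible T"
    and N: "distributed M lborel N q" and Y: "distributed M lborel Y p"
    and NY: "distributed M (lborel \<Otimes>\<^sub>M lborel) (\<lambda>\<omega>. (N \<omega>, Y \<omega>)) (\<lambda>(n, y). q n * p y)"
    and q [measurable]: "q \<in> borel_measurable borel" and q_pos: "\<And>n. 0 < q n"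
    and p [measurable]: "p \<in> borel_measurable borel" and p_pos: "\<And>y. 0 < p y"
    and h [measurable]: "h \<in> borel_measurable borel"
    and int: "integrable lborel (\<lambda>n. q n * log b (q n))"
    and W: "\<And>\<omega>. \<omega> \<in> space M \<Longrightarrow> W \<omega> = h (Y \<omega>) + T *v N \<omega>"
  shows "conditional_entropy b lborel lborel W Y = log b \<bar>det T\<bar> - (\<integral>n. q n * log b (q n) \<partial>lborel)"
proof -
  note [measurable] = measurable_compose[OF _ borel_measurable_matrix_vector_mult]
  have inv: "matrix_inv T *v (T *v x) = x" for x
    using T by (simp_all add: matrix_vector_mul_assoc matrix_inv_left)
  have det: "\<bar>det T\<bar> > 0"
    using T by (simp add: invertible_det_nz)
  have f: "(\<lambda>(n, y). q n * p y) \<in> borel_measurable borel"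
    unfolding borel_prod[symmetric] by measurable
  define P where "P = (\<lambda>(w, y). q (matrix_inv T *v (w - h y)) * p y / \<bar>det T\<bar>)"
  have P_nn: "0 \<le> P x" for x
    using q_pos p_pos det by (auto simp: P_def split_beta' intro!: less_imp_le)
  have [measurable]: "P \<in> borel_measurable (borel \<Otimes>\<^sub>M borel)"
    unfolding P_def by measurable
  have "distributed M (lborel \<Otimes>\<^sub>M lborel) (\<lambda>\<omega>. (h (Y \<omega>) + T *v N \<omega>, Y \<omega>)) P"
    using distributed_fibre_affine[OF T NY f h] by (simp add: P_def)
  \<comment> \<open>\<open>W\<close> is known only on the space of \<open>M\<close>, so law and
    measurability are transferred separately from the explicit expression.\<close>
  moreover have "distr M (lborel \<Otimes>\<^sub>M lborel) (\<lambda>\<omega>. (h (Y \<omega>) + T *v N \<omega>, Y \<omega>)) =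
      distr M (lborel \<Otimes>\<^sub>M lborel) (\<lambda>\<omega>. (W \<omega>, Y \<omega>))"
    by (rule distr_cong) (auto simp: W)
  moreover have "(\<lambda>\<omega>. (W \<omega>, Y \<omega>)) \<in> M \<rightarrow>\<^sub>M lborel \<Otimes>\<^sub>M lborel \<longleftrightarrow>
      (\<lambda>\<omega>. (h (Y \<omega>) + T *v N \<omega>, Y \<omega>)) \<in> M \<rightarrow>\<^sub>M lborel \<Otimes>\<^sub>M lborel"
    by (rule measurable_cong) (auto simp: W)
  ultimately have WY: "distributed M (lborel \<Otimes>\<^sub>M lborel) (\<lambda>\<omega>. (W \<omega>, Y \<omega>)) P"
    by (simp add: distributed_def)
  have "conditional_entropy b lborel lborel W Y =
      - (\<integral>(x, y). P (x, y) * log b (P (x, y) / p y) \<partial>(lborel \<Otimes>\<^sub>M lborel))"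
    by (rule conditional_entropy_generic_eq[OF _ _ Y _ WY])
      (auto intro: sigma_finite_lborel less_imp_le[OF p_pos] P_nn)
  also have "(\<integral>(x, y). P (x, y) * log b (P (x, y) / p y) \<partial>(lborel \<Otimes>\<^sub>M lborel)) =
      (\<integral>x. P x * log b (P x / p (snd x)) \<partial>(lborel \<Otimes>\<^sub>M lborel))"
    by (simp add: split_beta')
  also have "\<dots> = expectation (\<lambda>\<omega>. log b (P (W \<omega>, Y \<omega>) / p (Y \<omega>)))"
    by (subst distributed_integral[OF WY]) (auto simp: P_nn)
  also have "\<dots> = expectation (\<lambda>\<omega>. log b (q (N \<omega>)) - log b \<bar>det T\<bar>)"
  proof (rule Bochner_Integration.integral_cong)
    fix \<omega> assume "\<omega> \<in> space M"
    moreover have "p (Y \<omega>) \<noteq> 0"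
      using p_pos[of "Y \<omega>"] by simp
    ultimately have "P (W \<omega>, Y \<omega>) / p (Y \<omega>) = q (N \<omega>) / \<bar>det T\<bar>"
      by (simp add: P_def W inv)
    then show "log b (P (W \<omega>, Y \<omega>) / p (Y \<omega>)) = log b (q (N \<omega>)) - log b \<bar>det T\<bar>"
      using q_pos[of "N \<omega>"] det by (simp add: log_divide)
  qed simp
  also have "\<dots> = expectation (\<lambda>\<omega>. log b (q (N \<omega>))) - log b \<bar>det T\<bar>"
  proof -
    have "integrable M (\<lambda>\<omega>. log b (q (N \<omega>)))"
      using distributed_integrable[OF N, of "\<lambda>n. log b (q n)"] int q_pos by (auto intro: less_imp_le)
    then show ?thesis
      by (simp add: prob_space)
  qed
  also have "expectation (\<lambda>\<omega>. log b (q (N \<omega>))) = (\<integral>n. q n * log b (q n) \<partial>lborel)"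
    using distributed_integral[OF N, of "\<lambda>n. log b (q n)"] less_imp_le[OF q_pos] by simp
  finally show ?thesis
    by simp
qed

section \<open>Covariances\<close>

text \<open>A Bochner integral is 0 by convention when the function is not integrable, so
  bilinearity of covariance needs a side condition. This predicate is closed under the linear
  operations and makes products integrable.\<close>

definition sq_integrable :: "'a measure \<Rightarrow> ('a \<Rightarrow> real) \<Rightarrow> bool" where
  "sq_integrable M X \<longleftrightarrow> X \<in> borel_measurable M \<and> integrable M (\<lambda>\<omega>. (X \<omega>)\<^sup>2)"

definition covariance :: "'a measure \<Rightarrow> ('a \<Rightarrow> real) \<Rightarrow> ('a \<Rightarrow> real) \<Rightarrow> real" where
  "covariance M X Y = (\<integral>\<omega>. (X \<omega> - (\<integral>\<omega>. X \<omega> \<partial>M)) * (Y \<omega> - (\<integral>\<omega>. Y \<omega> \<partial>M)) \<partial>M)"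

lemma sq_integrable_measurable [measurable_dest]: "sq_integrable M X \<Longrightarrow> X \<in> borel_measurable M"
  by (simp add: sq_integrable_def)

lemma sq_integrable_mult:
  assumes "sq_integrable M X" "sq_integrable M Y"
  shows "integrable M (\<lambda>\<omega>. X \<omega> * Y \<omega>)"
proof (rule Bochner_Integration.integrable_bound)
  show "integrable M (\<lambda>\<omega>. (X \<omega>)\<^sup>2 + (Y \<omega>)\<^sup>2)"
    using assms by (simp add: sq_integrable_def)
  show "AE \<omega> in M. norm (X \<omega> * Y \<omega>) \<le> norm ((X \<omega>)\<^sup>2 + (Y \<omega>)\<^sup>2)"
  proof (rule AE_I2)
    fix \<omega>
    have "2 * \<bar>X \<omega>\<bar> * \<bar>Y \<omega>\<bar> \<le> (X \<omega>)\<^sup>2 + (Y \<omega>)\<^sup>2"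
      using sum_squares_bound[of "\<bar>X \<omega>\<bar>" "\<bar>Y \<omega>\<bar>"] by simp
    moreover have "0 \<le> \<bar>X \<omega>\<bar> * \<bar>Y \<omega>\<bar>"
      by simp
    ultimately show "norm (X \<omega> * Y \<omega>) \<le> norm ((X \<omega>)\<^sup>2 + (Y \<omega>)\<^sup>2)"
      unfolding real_norm_def abs_mult by linarith
  qed
qed (use assms in measurable)

lemma sq_integrable_add:
  assumes "sq_integrable M X" "sq_integrable M Y"
  shows "sq_integrable M (\<lambda>\<omega>. X \<omega> + Y \<omega>)"
  using assms sq_integrable_mult[OF assms]
  by (auto simp: sq_integrable_def power2_sum mult.assoc)

lemma sq_integrable_cmult:
  assumes "sq_integrable M X"
  shows "sq_integrable M (\<lambda>\<omega>. c * X \<omega>)"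
  using assms by (auto simp: sq_integrable_def power_mult_distrib)

lemma sq_integrable_sum:
  assumes "\<And>i. i \<in> I \<Longrightarrow> sq_integrable M (X i)"
  shows "sq_integrable M (\<lambda>\<omega>. \<Sum>i\<in>I. X i \<omega>)"
  using assms
proof (induction I rule: infinite_finite_induct)
  case (insert i I)
  then show ?case
    by (simp add: sq_integrable_add)
qed (simp_all add: sq_integrable_def)

context prob_space
begin

lemma sq_integrable_imp_integrable: "sq_integrable M X \<Longrightarrow> integrable M X"
  using sq_integrable_mult[of M X "\<lambda>_. 1"] by (simp add: sq_integrable_def)

lemma covariance_eq:
  assumes "sq_integrable M X" "sq_integrable M Y"
  shows "covariance M X Y = expectation (\<lambda>\<omega>. X \<omega> * Y \<omega>) - expectation X * expectation Y"
proof -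
  note [simp] = sq_integrable_imp_integrable[OF assms(1)] sq_integrable_imp_integrable[OF assms(2)] sq_integrable_mult[OF assms]
  have "covariance M X Y = expectation (\<lambda>\<omega>. X \<omega> * Y \<omega> - X \<omega> * expectation Y - expectation X * Y \<omega> + expectation X * expectation Y)"
    unfolding covariance_def by (rule Bochner_Integration.integral_cong) (auto simp: algebra_simps)
  then show ?thesis
    by (simp add: prob_space)
qed

lemma covariance_add_left:
  assumes "sq_integrable M X" "sq_integrable M X'" "sq_integrable M Y"
  shows "covariance M (\<lambda>\<omega>. X \<omega> + X' \<omega>) Y = covariance M X Y + covariance M X' Y"
  using assms by (simp add: covariance_eq sq_integrable_add sq_integrable_mult sq_integrable_imp_integrable algebra_simps)

lemma covariance_cmult_left:
  assumes "sq_integrable M X" "sq_integrable M Y"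
  shows "covariance M (\<lambda>\<omega>. c * X \<omega>) Y = c * covariance M X Y"
  using assms by (simp add: covariance_eq sq_integrable_cmult sq_integrable_mult sq_integrable_imp_integrable algebra_simps)

lemma covariance_sum_left:
  assumes "\<And>i. i \<in> I \<Longrightarrow> sq_integrable M (X i)" "sq_integrable M Y"
  shows "covariance M (\<lambda>\<omega>. \<Sum>i\<in>I. X i \<omega>) Y = (\<Sum>i\<in>I. covariance M (X i) Y)"
  using assms
proof (induction I rule: infinite_finite_induct)
  case (insert i I)
  then show ?case
    by (simp add: covariance_add_left sq_integrable_sum)
qed (simp_all add: covariance_def)

lemma covariance_commute: "covariance M X Y = covariance M Y X"
  by (simp add: covariance_def mult.commute)

lemma covariance_add_right:
  assumes "sq_integrable M X" "sq_integrable M Y" "sq_integrable M Y'"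
  shows "covariance M X (\<lambda>\<omega>. Y \<omega> + Y' \<omega>) = covariance M X Y + covariance M X Y'"
  using covariance_add_left[OF assms(2,3,1)] by (simp add: covariance_commute[of X])

end

definition vec_sq_integrable :: "'a measure \<Rightarrow> ('a \<Rightarrow> real ^ 'n) \<Rightarrow> bool" where
  "vec_sq_integrable M X \<longleftrightarrow> (\<forall>i. sq_integrable M (\<lambda>\<omega>. X \<omega> $ i))"

definition cross_covariance ::
    "'a measure \<Rightarrow> ('a \<Rightarrow> real ^ 'n) \<Rightarrow> ('a \<Rightarrow> real ^ 'm) \<Rightarrow> real ^ 'm ^ 'n" where
  "cross_covariance M X Y = (\<chi> i j. covariance M (\<lambda>\<omega>. X \<omega> $ i) (\<lambda>\<omega>. Y \<omega> $ j))"

lemma covariance_matrix_eq_cross_covariance: "covariance_matrix M X = cross_covariance M X X"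
  by (simp add: covariance_matrix_def cross_covariance_def covariance_def)

lemma vec_sq_integrable_matrix:
  fixes A :: "real ^ 'n::finite ^ 'm::finite"
  assumes "vec_sq_integrable M X"
  shows "vec_sq_integrable M (\<lambda>\<omega>. A *v X \<omega>)"
  using assms by (auto simp: vec_sq_integrable_def matrix_vector_mult_def intro!: sq_integrable_sum sq_integrable_cmult)

lemma vec_sq_integrable_add:
  assumes "vec_sq_integrable M X" "vec_sq_integrable M Y"
  shows "vec_sq_integrable M (\<lambda>\<omega>. X \<omega> + Y \<omega>)"
  using assms by (auto simp: vec_sq_integrable_def intro!: sq_integrable_add)

context prob_space
begin

lemma cross_covariance_transpose: "transpose (cross_covariance M X Y) = cross_covariance M Y X"
  by (simp add: cross_covariance_def transpose_def vec_eq_iff covariance_commute)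

lemma cross_covariance_matrix_left:
  fixes A :: "real ^ 'n::finite ^ 'm::finite"
  assumes "vec_sq_integrable M X" "vec_sq_integrable M Y"
  shows "cross_covariance M (\<lambda>\<omega>. A *v X \<omega>) Y = A ** cross_covariance M X Y"
  using assms unfolding vec_sq_integrable_def
  by (simp add: cross_covariance_def vec_eq_iff matrix_vector_mult_def matrix_matrix_mult_def
      covariance_sum_left covariance_cmult_left sq_integrable_cmult)

lemma cross_covariance_matrix_right:
  fixes A :: "real ^ 'n::finite ^ 'm::finite"
  assumes "vec_sq_integrable M X" "vec_sq_integrable M Y"
  shows "cross_covariance M Y (\<lambda>\<omega>. A *v X \<omega>) = cross_covariance M Y X ** transpose A"
proof -
  have "transpose (cross_covariance M (\<lambda>\<omega>. A *v X \<omega>) Y) = cross_covariance M Y X ** transpose A"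
    by (simp add: cross_covariance_matrix_left[OF assms] matrix_transpose_mul cross_covariance_transpose)
  then show ?thesis
    by (simp add: cross_covariance_transpose)
qed

lemma cross_covariance_add_left:
  assumes "vec_sq_integrable M X" "vec_sq_integrable M X'" "vec_sq_integrable M Y"
  shows "cross_covariance M (\<lambda>\<omega>. X \<omega> + X' \<omega>) Y = cross_covariance M X Y + cross_covariance M X' Y"
  using assms unfolding vec_sq_integrable_def
  by (simp add: cross_covariance_def vec_eq_iff covariance_add_left)

lemma cross_covariance_add_right:
  assumes "vec_sq_integrable M X" "vec_sq_integrable M X'" "vec_sq_integrable M Y"
  shows "cross_covariance M Y (\<lambda>\<omega>. X \<omega> + X' \<omega>) = cross_covariance M Y X + cross_covariance M Y X'"
  using assms unfolding vec_sq_integrable_def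
  by (simp add: cross_covariance_def vec_eq_iff covariance_add_left covariance_commute[of "\<lambda>\<omega>. Y \<omega> $ i" for i])

lemma sq_integrable_inner:
  fixes a :: "real ^ 'n::finite"
  assumes "vec_sq_integrable M X"
  shows "sq_integrable M (\<lambda>\<omega>. a \<bullet> X \<omega>)"
  using assms by (auto simp: vec_sq_integrable_def inner_vec_def intro!: sq_integrable_sum sq_integrable_cmult)

lemma expectation_inner:
  fixes a :: "real ^ 'n::finite"
  assumes "vec_sq_integrable M X"
  shows "expectation (\<lambda>\<omega>. a \<bullet> X \<omega>) = a \<bullet> (\<chi> i. expectation (\<lambda>\<omega>. X \<omega> $ i))"
  using assms by (simp add: vec_sq_integrable_def inner_vec_def sq_integrable_imp_integrable)

lemma covariance_inner:
  fixes a :: "real ^ 'n::finite" and c :: "real ^ 'm::finite"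
  assumes X: "vec_sq_integrable M X" and Y: "vec_sq_integrable M Y"
  shows "covariance M (\<lambda>\<omega>. a \<bullet> X \<omega>) (\<lambda>\<omega>. c \<bullet> Y \<omega>) = a \<bullet> (cross_covariance M X Y *v c)"
proof -
  have X': "sq_integrable M (\<lambda>\<omega>. X \<omega> $ i)" and Y': "sq_integrable M (\<lambda>\<omega>. Y \<omega> $ j)" for i j
    using X Y by (auto simp: vec_sq_integrable_def)
  have "covariance M (\<lambda>\<omega>. a \<bullet> X \<omega>) (\<lambda>\<omega>. c \<bullet> Y \<omega>) = (\<Sum>i\<in>UNIV. a $ i * covariance M (\<lambda>\<omega>. X \<omega> $ i) (\<lambda>\<omega>. c \<bullet> Y \<omega>))"
    using X' sq_integrable_inner[OF Y]
    by (simp add: inner_vec_def[of a] covariance_sum_left covariance_cmult_left sq_integrable_cmult)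
  also have "\<dots> = (\<Sum>i\<in>UNIV. a $ i * (\<Sum>j\<in>UNIV. c $ j * covariance M (\<lambda>\<omega>. X \<omega> $ i) (\<lambda>\<omega>. Y \<omega> $ j)))"
    using X' Y'
    by (simp add: inner_vec_def[of c] covariance_commute[of "\<lambda>\<omega>. X \<omega> $ i" for i]
        covariance_sum_left covariance_cmult_left sq_integrable_cmult)
  finally show ?thesis
    by (simp add: inner_vec_def cross_covariance_def matrix_vector_mult_def mult.commute)
qed

text \<open>The quadratic form at \<open>v\<close> is the variance of \<open>v \<bullet> X\<close>.
  If it were zero, \<open>v \<bullet> X\<close> would be almost surely constant and hence
  uncorrelated with every coordinate of \<open>X\<close>; then the covariance matrix would map
  \<open>v\<close> to 0, against invertibility.\<close>

lemma covariance_matrix_pos_def: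
  fixes X :: "'a \<Rightarrow> real ^ 'n::finite"
  assumes X: "vec_sq_integrable M X" and inv: "invertible (cross_covariance M X X)" and v: "v \<noteq> 0"
  shows "0 < v \<bullet> (cross_covariance M X X *v v)"
proof -
  let ?Y = "\<lambda>\<omega>. v \<bullet> X \<omega>"
  have Y: "sq_integrable M ?Y"
    by (rule sq_integrable_inner[OF X])
  then have [measurable]: "?Y \<in> borel_measurable M"
    by (rule sq_integrable_measurable)
  have "covariance M ?Y ?Y = expectation (\<lambda>\<omega>. (?Y \<omega> - expectation ?Y)\<^sup>2)"
    by (simp add: covariance_def power2_eq_square)
  moreover have "covariance M ?Y ?Y \<noteq> 0"
  proof
    assume "covariance M ?Y ?Y = 0"
    moreover have "sq_integrable M (\<lambda>\<omega>. ?Y \<omega> + (- expectation ?Y))"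
      using Y by (intro sq_integrable_add) (auto simp: sq_integrable_def)
    ultimately have "AE \<omega> in M. (?Y \<omega> - expectation ?Y)\<^sup>2 = 0"
      using integral_nonneg_eq_0_iff_AE[of M "\<lambda>\<omega>. (?Y \<omega> - expectation ?Y)\<^sup>2"]
      by (simp add: sq_integrable_def covariance_def power2_eq_square)
    then have "AE \<omega> in M. ?Y \<omega> - expectation ?Y = 0"
      by simp
    then have "covariance M (\<lambda>\<omega>. axis i 1 \<bullet> X \<omega>) ?Y = 0" for i
    proof -
      have "AE \<omega> in M. (axis i 1 \<bullet> X \<omega> - expectation (\<lambda>\<omega>. axis i 1 \<bullet> X \<omega>)) * (?Y \<omega> - expectation ?Y) = 0"
        using \<open>AE \<omega> in M. ?Y \<omega> - expectation ?Y = 0\<close> by eventually_elim simp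
      then show ?thesis
        unfolding covariance_def by (rule integral_eq_zero_AE)
    qed
    then have "axis i 1 \<bullet> (cross_covariance M X X *v v) = 0" for i
      by (simp only: covariance_inner[OF X X])
    then have "cross_covariance M X X *v v = 0"
      by (simp add: inner_axis' vec_eq_iff)
    then show False
      using inj_matrix_vector_mult[OF inv] v by (metis injD matrix_vector_mult_0_right)
  qed
  ultimately have "0 < covariance M ?Y ?Y"
    by (simp add: order.strict_iff_order)
  then show ?thesis
    by (simp add: covariance_inner[OF X X])
qed

end

text \<open>The rows of \<open>E\<close> are an orthonormal family for the inner product defined by
  \<open>S\<close>, and \<open>E ** S ** transpose E\<close> is their Gram matrix. The index type
  carries no order, so the family is built by induction on finite sets of indices.\<close>

lemma whitening_matrix_exists:
  fixes S :: "real ^ 'n ^ 'n::finite"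
  assumes sym: "transpose S = S" and pos: "\<And>v. v \<noteq> 0 \<Longrightarrow> 0 < v \<bullet> (S *v v)"
  obtains E :: "real ^ 'n ^ 'n" where "E ** S ** transpose E = mat 1"
proof -
  have "\<exists>e. \<forall>i\<in>I. \<forall>j\<in>I. e i \<bullet> (S *v e j) = (if i = j then 1 else 0)" if "finite I" for I :: "'n set"
    using that
  proof induction
    case (insert k I)
    then obtain e where e: "\<And>i j. i \<in> I \<Longrightarrow> j \<in> I \<Longrightarrow> e i \<bullet> (S *v e j) = (if i = j then 1 else 0)"
      by blast
    \<comment> \<open>Gram--Schmidt for the inner product given by \<open>S\<close>\<close>
    have "dim ((\<lambda>i. S *v e i) ` I) \<le> card ((\<lambda>i. S *v e i) ` I)"
      using insert by (intro dim_le_card') simp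
    also have "\<dots> \<le> card I"
      using insert by (intro card_image_le)
    \<comment> \<open>The index \<open>k\<close> lies outside \<open>I\<close>, so the vectors
      \<open>S *v e i\<close> cannot span the space. A nonzero vector that is Euclidean-orthogonal
      to them is \<open>S\<close>-orthogonal to every \<open>e i\<close>, and no projections need to
      be subtracted.\<close>
    also have "\<dots> < CARD('n)"
      using insert by (intro psubset_card_mono) auto
    finally obtain x where x: "x \<noteq> 0" "\<And>y. y \<in> span ((\<lambda>i. S *v e i) ` I) \<Longrightarrow> orthogonal x y"
      using orthogonal_to_subspace_exists[of "(\<lambda>i. S *v e i) ` I"] by auto
    define c where "c = x \<bullet> (S *v x)"
    have c: "c > 0"
      using pos x by (simp add: c_def)
    have left: "x \<bullet> (S *v e i) = 0" if "i \<in> I" for i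
      using x(2)[of "S *v e i"] that by (simp add: orthogonal_def span_base)
    have right: "e i \<bullet> (S *v x) = 0" if "i \<in> I" for i
      using left[OF that] by (metis dot_lmul_matrix sym transpose_matrix_vector inner_commute)
    define e' where "e' = e(k := (1 / sqrt c) *\<^sub>R x)"
    have "\<forall>i\<in>insert k I. \<forall>j\<in>insert k I. e' i \<bullet> (S *v e' j) = (if i = j then 1 else 0)"
      using insert.hyps c e left right
      by (auto simp: e'_def matrix_vector_mult_scaleR c_def[symmetric])
    then show ?case
      by blast
  qed simp
  from this[of UNIV] obtain e :: "'n \<Rightarrow> real ^ 'n"
    where e: "\<And>i j. e i \<bullet> (S *v e j) = (if i = j then 1 else 0)"
    by auto
  have "(\<chi> i. e i) ** S ** transpose (\<chi> i. e i) = mat 1"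
  proof -
    have "((\<chi> i. e i) ** S ** transpose (\<chi> i. e i)) $ i $ j = e i \<bullet> (S *v e j)" for i j
      unfolding matrix_mul_assoc[symmetric]
      by (simp add: matrix_matrix_mult_def transpose_def inner_vec_def matrix_vector_mult_def)
    then show ?thesis
      by (simp add: vec_eq_iff e mat_def)
  qed
  then show thesis
    by (rule that)
qed

section \<open>Conditional entropy of Gaussian vectors\<close>

lemma gaussian_sq_integrable:
  assumes "prob_space M" "gaussian M V"
  shows "sq_integrable M (\<lambda>\<omega>. v \<bullet> V \<omega>)"
  using assms gaussian_real_char(2)[OF assms(1), of "\<lambda>\<omega>. v \<bullet> V \<omega>"]
  by (auto simp: gaussian_def sq_integrable_def gaussian_real_def)

lemma gaussian_vec_sq_integrable:
  fixes V :: "'a \<Rightarrow> real ^ 'n::finite"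
  assumes "prob_space M" "gaussian M V"
  shows "vec_sq_integrable M V"
  unfolding vec_sq_integrable_def
proof
  fix i
  show "sq_integrable M (\<lambda>\<omega>. V \<omega> $ i)"
    using gaussian_sq_integrable[OF assms, of "axis i 1"] by (simp add: inner_axis')
qed

text \<open>A projection of \<open>f (V \<omega>)\<close> along \<open>v\<close> is the projection
  of \<open>V \<omega>\<close> along \<open>adjoint f v\<close>. As point masses count as Gaussian,
  \<open>f\<close> may be singular.\<close>

lemma gaussian_linear:
  fixes f :: "'b::euclidean_space \<Rightarrow> 'c::euclidean_space"
  assumes V: "gaussian M V" and f: "linear f"
  shows "gaussian M (\<lambda>\<omega>. f (V \<omega>))"
proof -
  have "v \<bullet> f x = adjoint f v \<bullet> x" for v x
    using adjoint_works[OF f, of x v] by (simp add: inner_commute)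
  moreover have "f \<in> borel_measurable borel"
    using f by (intro borel_measurable_continuous_onI linear_continuous_on linear_conv_bounded_linear[THEN iffD1])
  ultimately show ?thesis
    using V by (auto simp: gaussian_def intro: measurable_compose)
qed

text \<open>The logarithm of the density is affine in the squared norm. Integrability is therefore a
  second moment statement, which is taken from a random vector with this density.\<close>

lemma std_gaussian_log_integrable:
  assumes V: "distributed M lborel (V :: 'a \<Rightarrow> 'b::euclidean_space) std_gaussian_density"
    and sq: "\<And>b. sq_integrable M (\<lambda>\<omega>. b \<bullet> V \<omega>)" and "prob_space M"
  shows "integrable lborel (\<lambda>x :: 'b. std_gaussian_density x * log b (std_gaussian_density x))"
proof -
  interpret prob_space M by fact
  have eq: "log b (std_gaussian_density x) = (- (norm x)\<^sup>2 / 2 - ln (sqrt (2 * pi) ^ DIM('b))) / ln b" for x :: 'b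
    by (simp add: log_def std_gaussian_density_def ln_div)
  have "integrable M (\<lambda>\<omega>. (norm (V \<omega>))\<^sup>2)"
    unfolding norm_power2_eq_sum using sq by (simp add: sq_integrable_def inner_commute)
  then have "integrable M (\<lambda>\<omega>. log b (std_gaussian_density (V \<omega>)))"
    unfolding eq by simp
  then show ?thesis
    using distributed_integrable[OF V, of "\<lambda>x. log b (std_gaussian_density x)"]
    by (simp add: less_imp_le[OF std_gaussian_density_pos])
qed

text \<open>\<open>R\<close> and \<open>X\<close> are whitened separately; as their cross covariance
  vanishes, this also whitens the pair. Undoing the whitening of \<open>R\<close> is an affine map
  whose squared determinant is the determinant of the covariance. The entropy of the standard
  Gaussian stays an unevaluated integral since only its independence of \<open>R\<close> and
  \<open>X\<close> matters. Positivity of the determinant is stated as well, for splitting a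
  logarithm of a quotient later.\<close>

lemma (in information_space) conditional_entropy_gaussian:
  fixes R W :: "'a \<Rightarrow> real ^ 'n::finite" and X :: "'a \<Rightarrow> real ^ 'k::finite"
  assumes RX: "gaussian M (\<lambda>\<omega>. (R \<omega>, X \<omega>))"
    and uncorr: "cross_covariance M R X = 0"
    and R_pos: "\<And>v. v \<noteq> 0 \<Longrightarrow> 0 < v \<bullet> (cross_covariance M R R *v v)"
    and X_pos: "\<And>v. v \<noteq> 0 \<Longrightarrow> 0 < v \<bullet> (cross_covariance M X X *v v)"
    and g [measurable]: "g \<in> borel_measurable borel"
    and W: "\<And>\<omega>. \<omega> \<in> space M \<Longrightarrow> W \<omega> = g (X \<omega>) + R \<omega>"
  shows "0 < det (cross_covariance M R R)"
    and "conditional_entropy b lborel lborel W X = 1 / 2 * log b (det (cross_covariance M R R))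
      - (\<integral>x. std_gaussian_density (x :: real ^ 'n) * log b (std_gaussian_density x) \<partial>lborel)"
proof -
  note [measurable] = measurable_compose[OF _ borel_measurable_matrix_vector_mult]
  have R: "gaussian M R"
    using gaussian_linear[OF RX linear_fst] by simp
  have X: "gaussian M X"
    using gaussian_linear[OF RX linear_snd] by simp
  have [measurable]: "R \<in> borel_measurable M" "X \<in> borel_measurable M"
    using R X by (auto simp: gaussian_def)
  have R_sq: "vec_sq_integrable M R" and X_sq: "vec_sq_integrable M X"
    by (simp_all add: gaussian_vec_sq_integrable prob_space_axioms R X)
  obtain E :: "real ^ 'n ^ 'n" where E: "E ** cross_covariance M R R ** transpose E = mat 1"
    using whitening_matrix_exists[of "cross_covariance M R R"] R_pos by (auto simp: cross_covariance_transpose)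
  obtain F :: "real ^ 'k ^ 'k" where F: "F ** cross_covariance M X X ** transpose F = mat 1"
    using whitening_matrix_exists[of "cross_covariance M X X"] X_pos by (auto simp: cross_covariance_transpose)
  define mR where "mR = (\<chi> i. expectation (\<lambda>\<omega>. R \<omega> $ i))"
  define mX where "mX = (\<chi> i. expectation (\<lambda>\<omega>. X \<omega> $ i))"
  define N where "N \<omega> = E *v (R \<omega> - mR)" for \<omega>
  define N' where "N' \<omega> = F *v (X \<omega> - mX)" for \<omega>
  have [measurable]: "N \<in> borel_measurable M" "N' \<in> borel_measurable M"
    unfolding N_def N'_def by measurable
  have invE: "invertible E" and invF: "invertible F"
    using E F by (auto simp: invertible_right_inverse matrix_mul_assoc[symmetric])
  have det_E: "(det E)\<^sup>2 * det (cross_covariance M R R) = 1"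
    using arg_cong[OF E, of det] by (simp add: det_mul det_transpose power2_eq_square mult.commute mult.left_commute)
  show det_pos: "0 < det (cross_covariance M R R)"
    using det_E by (metis zero_less_mult_pos zero_less_one zero_le_power2 order.strict_iff_order mult_zero_left zero_neq_one)
  \<comment> \<open>The pair is treated once; setting \<open>r = 0\<close> or \<open>s = 0\<close>
    afterwards gives the marginal laws.\<close>
  have cf: "(CLINT \<omega>|M. iexp ((s, r) \<bullet> (N \<omega>, N' \<omega>))) = of_real (exp (- (norm (s, r))\<^sup>2 / 2))" for s r
  proof -
    \<comment> \<open>Transposing moves the whitening matrices to the test vectors, which turns the
      exponent into a centred projection of \<open>(R, X)\<close>, known to be a Gaussian
      variable.\<close>
    define a a' where "a = transpose E *v s" and "a' = transpose F *v r"
    define w where "w = (a, a')"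
    let ?L = "\<lambda>\<omega>. w \<bullet> (R \<omega>, X \<omega>)"
    have s1: "s \<bullet> (E *v x) = a \<bullet> x" and r1: "r \<bullet> (F *v y) = a' \<bullet> y" for x y
      by (simp_all add: a_def a'_def dot_lmul_matrix[symmetric] transpose_matrix_vector)
    have sqR: "sq_integrable M (\<lambda>\<omega>. a \<bullet> R \<omega>)" and sqX: "sq_integrable M (\<lambda>\<omega>. a' \<bullet> X \<omega>)"
      by (simp_all add: sq_integrable_inner R_sq X_sq)
    have mean: "expectation ?L = a \<bullet> mR + a' \<bullet> mX"
      by (simp add: w_def expectation_inner R_sq X_sq mR_def mX_def sq_integrable_imp_integrable sqR sqX)
    have L: "(s, r) \<bullet> (N \<omega>, N' \<omega>) = ?L \<omega> - expectation ?L" for \<omega>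
      unfolding mean by (simp add: N_def N'_def w_def s1 r1 inner_diff_right)
    have "variance ?L = covariance M ?L ?L"
      by (simp add: covariance_def power2_eq_square)
    also have "\<dots> = covariance M (\<lambda>\<omega>. a \<bullet> R \<omega>) (\<lambda>\<omega>. a \<bullet> R \<omega>)
        + 2 * covariance M (\<lambda>\<omega>. a \<bullet> R \<omega>) (\<lambda>\<omega>. a' \<bullet> X \<omega>)
        + covariance M (\<lambda>\<omega>. a' \<bullet> X \<omega>) (\<lambda>\<omega>. a' \<bullet> X \<omega>)"
      unfolding w_def inner_Pair
      by (simp add: covariance_add_left covariance_add_right sq_integrable_add sqR sqX
          covariance_commute[of "\<lambda>\<omega>. a' \<bullet> X \<omega>" "\<lambda>\<omega>. a \<bullet> R \<omega>"])
    also have "\<dots> = s \<bullet> s + r \<bullet> r"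
      unfolding covariance_inner[OF R_sq R_sq] covariance_inner[OF R_sq X_sq] covariance_inner[OF X_sq X_sq]
      unfolding s1[symmetric] r1[symmetric]
      unfolding a_def a'_def matrix_vector_mul_assoc
      by (simp add: uncorr E F matrix_mul_assoc)
    finally have "variance ?L = (norm (s, r))\<^sup>2"
      by (simp add: norm_Pair power2_norm_eq_inner)
    moreover have "gaussian_real M ?L"
      using RX unfolding gaussian_def by blast
    ultimately show ?thesis
      unfolding L using gaussian_real_char(1)[OF prob_space_axioms, of ?L] by simp
  qed
  have dNN': "distributed M lborel (\<lambda>\<omega>. (N \<omega>, N' \<omega>)) std_gaussian_density"
  proof (rule distributed_std_gaussianI[OF prob_space_axioms])
    show "(CLINT \<omega>|M. iexp (t \<bullet> (N \<omega>, N' \<omega>))) = of_real (exp (- (norm t)\<^sup>2 / 2))" for t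
      using cf[of "fst t" "snd t"] by simp
  qed measurable
  have dN: "distributed M lborel N std_gaussian_density"
  proof (rule distributed_std_gaussianI[OF prob_space_axioms])
    show "(CLINT \<omega>|M. iexp (t \<bullet> N \<omega>)) = of_real (exp (- (norm t)\<^sup>2 / 2))" for t
      using cf[of t 0] by (simp add: norm_Pair)
  qed measurable
  have dN': "distributed M lborel N' std_gaussian_density"
  proof (rule distributed_std_gaussianI[OF prob_space_axioms])
    show "(CLINT \<omega>|M. iexp (t \<bullet> N' \<omega>)) = of_real (exp (- (norm t)\<^sup>2 / 2))" for t
      using cf[of 0 t] by (simp add: norm_Pair)
  qed measurable
  define T where "T = matrix_inv E"
  define T' where "T' = matrix_inv F"
  have T: "invertible T" "invertible T'"
    unfolding T_def T'_def using invE invF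
    by (meson invertible_def matrix_inv_left matrix_inv_right)+
  have R_eq: "R \<omega> = mR + T *v N \<omega>" and X_eq: "X \<omega> = mX + T' *v N' \<omega>" for \<omega>
    by (simp_all add: N_def N'_def T_def T'_def matrix_vector_mul_assoc matrix_inv_left invE invF)
  define p where "p x = std_gaussian_density (matrix_inv T' *v (x - mX)) / \<bar>det T'\<bar>" for x
  have det_T': "det T' \<noteq> 0"
    using T by (simp add: invertible_det_nz)
  have [measurable]: "p \<in> borel_measurable borel"
    unfolding p_def by measurable
  have dX: "distributed M lborel X p"
    using distributed_matrix_affine[OF T(2) dN', of mX] by (simp add: X_eq[symmetric] p_def)
  \<comment> \<open>\<open>distributed_fibre_affine\<close> transforms the first component only. The
    pair is swapped to replace \<open>N'\<close> by \<open>X\<close>, and swapped back to have the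
    noise in front.\<close>
  have dN'N: "distributed M (lborel \<Otimes>\<^sub>M lborel) (\<lambda>\<omega>. (N' \<omega>, N \<omega>))
      (\<lambda>x. ennreal (std_gaussian_density (snd x) * std_gaussian_density (fst x)))"
    using distributed_swap[of lborel lborel N N' std_gaussian_density] dNN'
    by (simp add: lborel_prod sigma_finite_lborel std_gaussian_density_Pair split_beta')
  have "distributed M (lborel \<Otimes>\<^sub>M lborel) (\<lambda>\<omega>. (mX + T' *v N' \<omega>, N \<omega>))
      (\<lambda>(x, n). (\<lambda>x. std_gaussian_density (snd x) * std_gaussian_density (fst x)) (matrix_inv T' *v (x - mX), n) / \<bar>det T'\<bar>)"
    by (rule distributed_fibre_affine[OF T(2) dN'N]) (simp_all add: borel_prod[symmetric])
  then have dXN: "distributed M (lborel \<Otimes>\<^sub>M lborel) (\<lambda>\<omega>. (X \<omega>, N \<omega>)) (\<lambda>x. ennreal (std_gaussian_density (snd x) * p (fst x)))"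
    by (simp add: X_eq[symmetric] p_def split_beta')
  have dNX: "distributed M (lborel \<Otimes>\<^sub>M lborel) (\<lambda>\<omega>. (N \<omega>, X \<omega>)) (\<lambda>(n, x). ennreal (std_gaussian_density n * p x))"
    using distributed_swap[OF sigma_finite_lborel sigma_finite_lborel dXN] by (simp add: split_beta')
  have "conditional_entropy b lborel lborel W X = log b \<bar>det T\<bar> -
      (\<integral>x. std_gaussian_density (x :: real ^ 'n) * log b (std_gaussian_density x) \<partial>lborel)"
  proof (rule conditional_entropy_affine_noise[OF T(1) dN dX])
    show "distributed M (lborel \<Otimes>\<^sub>M lborel) (\<lambda>\<omega>. (N \<omega>, X \<omega>)) (\<lambda>x. ennreal (case x of (n, x) \<Rightarrow> std_gaussian_density n * p x))"
      using dNX by (simp add: split_beta')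
    show "0 < p x" for x
      using det_T' by (simp add: p_def std_gaussian_density_pos)
    \<comment> \<open>The mean of the noise is absorbed into the function of
      \<open>X\<close>.\<close>
    show "W \<omega> = (\<lambda>x. g x + mR) (X \<omega>) + T *v N \<omega>" if "\<omega> \<in> space M" for \<omega>
      using W[OF that] R_eq[of \<omega>] by simp
    show "integrable lborel (\<lambda>n :: real ^ 'n. std_gaussian_density n * log b (std_gaussian_density n))"
    proof (rule std_gaussian_log_integrable[OF dN _ prob_space_axioms])
      fix a :: "real ^ 'n"
      have "sq_integrable M (\<lambda>\<omega>. a \<bullet> (E *v R \<omega>) + - (a \<bullet> (E *v mR)))"
        by (intro sq_integrable_add sq_integrable_inner vec_sq_integrable_matrix R_sq) (simp add: sq_integrable_def)
      then show "sq_integrable M (\<lambda>\<omega>. a \<bullet> N \<omega>)"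
        by (simp add: N_def matrix_vector_mult_diff_distrib inner_diff_right)
    qed
  qed (simp_all add: std_gaussian_density_pos)
  moreover have "log b \<bar>det T\<bar> = 1 / 2 * log b (det (cross_covariance M R R))"
  proof -
    have "det E * det T = 1"
      using arg_cong[OF matrix_inv_right[OF invE], of det] by (simp add: det_mul T_def)
    then have "(det E)\<^sup>2 * (det T)\<^sup>2 = 1"
      by (simp add: power_mult_distrib[symmetric])
    then have "det (cross_covariance M R R) = \<bar>det T\<bar>\<^sup>2"
      using det_E by (metis mult_cancel_left power2_abs mult_zero_left zero_neq_one)
    moreover have "\<bar>det T\<bar> > 0"
      using T by (simp add: invertible_det_nz)
    ultimately show ?thesis
      using log_nat_power[of "\<bar>det T\<bar>" b 2] by simp
  qed
  ultimately show "conditional_entropy b lborel lborel W X = 1 / 2 * log b (det (cross_covariance M R R))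
      - (\<integral>x. std_gaussian_density (x :: real ^ 'n) * log b (std_gaussian_density x) \<partial>lborel)"
    by simp
qed

section \<open>The control system\<close>

definition lower_part :: "'c ^ ('n::finite + 'm::finite) \<Rightarrow> 'c ^ 'm" where
  "lower_part z = (\<chi> j. z $ Inr j)"

lemma sum_UNIV_sum:
  "(\<Sum>k\<in>(UNIV :: ('n::finite + 'm::finite) set). f k) = (\<Sum>i\<in>UNIV. f (Inl i)) + (\<Sum>j\<in>UNIV. f (Inr j))"
  by (simp add: UNIV_Plus_UNIV[symmetric] sum.Plus del: UNIV_Plus_UNIV)

lemma matrix_mult_minus_left:
  fixes A :: "'a::ring_1 ^ 'n::finite ^ 'm"
  shows "(- A) ** B = - (A ** B)"
  by (simp add: matrix_matrix_mult_def vec_eq_iff sum_negf)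

lemma upper_part_system_step:
  "upper_part (system_step (block_matrix Ax Axy Ayx Ay) (block_column Bx By) z v) =
    Ax *v upper_part z + (Axy *v lower_part z + Bx *v vec v)"
  by (simp add: vec_eq_iff upper_part_def lower_part_def system_step_def block_matrix_def block_column_def
      matrix_vector_mult_def sum_UNIV_sum)

lemma linear_upper_part: "linear (upper_part :: real ^ ('n::finite + 'm::finite) \<Rightarrow> real ^ 'n)"
  by (rule linearI) (simp_all add: upper_part_def vec_eq_iff)

lemma linear_lower_part: "linear (lower_part :: real ^ ('n::finite + 'm::finite) \<Rightarrow> real ^ 'm)"
  by (rule linearI) (simp_all add: lower_part_def vec_eq_iff)

lemma cross_covariance_blocks:
  assumes "covariance_matrix M Z = block_matrix P Q R S"
  shows "cross_covariance M (\<lambda>\<omega>. upper_part (Z \<omega>)) (\<lambda>\<omega>. upper_part (Z \<omega>)) = P"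
    and "cross_covariance M (\<lambda>\<omega>. upper_part (Z \<omega>)) (\<lambda>\<omega>. lower_part (Z \<omega>)) = Q"
    and "cross_covariance M (\<lambda>\<omega>. lower_part (Z \<omega>)) (\<lambda>\<omega>. lower_part (Z \<omega>)) = S"
proof -
  have "covariance M (\<lambda>\<omega>. Z \<omega> $ k) (\<lambda>\<omega>. Z \<omega> $ l) = block_matrix P Q R S $ k $ l" for k l
    using assms by (simp add: covariance_matrix_eq_cross_covariance cross_covariance_def vec_eq_iff)
  then show "cross_covariance M (\<lambda>\<omega>. upper_part (Z \<omega>)) (\<lambda>\<omega>. upper_part (Z \<omega>)) = P"
    and "cross_covariance M (\<lambda>\<omega>. upper_part (Z \<omega>)) (\<lambda>\<omega>. lower_part (Z \<omega>)) = Q"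
    and "cross_covariance M (\<lambda>\<omega>. lower_part (Z \<omega>)) (\<lambda>\<omega>. lower_part (Z \<omega>)) = S"
    by (simp_all add: cross_covariance_def upper_part_def lower_part_def block_matrix_def vec_eq_iff)
qed

text \<open>A coordinate may be pulled out of a vector-valued integral only if the integrand is
  integrable, for otherwise the integral is 0 by convention. Integrability is obtained by expanding
  the product in the standard basis.\<close>

lemma (in prob_space) integral_scaleR_vec_nth:
  fixes Z :: "'a \<Rightarrow> real ^ 'n::finite"
  assumes u: "sq_integrable M u" and Z: "vec_sq_integrable M Z"
  shows "expectation (\<lambda>\<omega>. u \<omega> *\<^sub>R Z \<omega>) $ i = expectation (\<lambda>\<omega>. u \<omega> * Z \<omega> $ i)"
proof -
  have "integrable M (\<lambda>\<omega>. (b \<bullet> (u \<omega> *\<^sub>R Z \<omega>)) *\<^sub>R b)" for b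
    using sq_integrable_mult[OF u sq_integrable_inner[OF Z, of b]] by simp
  then have "integrable M (\<lambda>\<omega>. \<Sum>b\<in>Basis. ((u \<omega> *\<^sub>R Z \<omega>) \<bullet> b) *\<^sub>R b)"
    by (intro Bochner_Integration.integrable_sum) (simp add: inner_commute)
  then have "integrable M (\<lambda>\<omega>. u \<omega> *\<^sub>R Z \<omega>)"
    by (simp only: euclidean_representation)
  from integral_bounded_linear[OF bounded_linear_vec_nth[of i] this] show ?thesis
    by simp
qed

text \<open>
  The hypothesis on \<open>E[u z]\<close> is about raw second moments; it yields zero covariance only because
  the input is centred.
\<close>

lemma (in prob_space) white_noise_mean_zero:
  fixes u :: "nat \<Rightarrow> 'a \<Rightarrow> real"
  assumes indep: "indep_vars (\<lambda>_. borel) u UNIV"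
    and ident: "\<And>s s'. distr M borel (u s) = distr M borel (u s')"
    and white: "\<And>s k. k \<noteq> 0 \<Longrightarrow> expectation (\<lambda>\<omega>. u s \<omega> * u (s + k) \<omega>) = 0"
    and int: "\<And>s. integrable M (u s)"
  shows "expectation (u t) = 0"
proof -
  have mean: "expectation (u s) = expectation (u t)" for s
    using integral_distr[of "u s" M borel "\<lambda>x. x :: real"] integral_distr[of "u t" M borel "\<lambda>x. x :: real"]
      ident[of s t] int[THEN borel_measurable_integrable] by simp
  \<comment> \<open>Independence makes the second moment at lag 1 the product of two equal means,
    and whiteness at lag 1 makes it zero, so the squared mean vanishes.\<close>
  have "indep_vars (\<lambda>_. borel) u {t, t + 1}"
    using indep_vars_subset[OF indep] by simp
  then have "expectation (\<lambda>\<omega>. \<Prod>s\<in>{t, t + 1}. u s \<omega>) = (\<Prod>s\<in>{t, t + 1}. expectation (u s))"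
    by (intro indep_vars_lebesgue_integral) (auto intro: int)
  then have "(expectation (u t))\<^sup>2 = 0"
    using white[of 1 t] mean[of "t + 1"] by (simp add: power2_eq_square)
  then show ?thesis
    by simp
qed

theorem mainTheorem3:
  fixes M :: "'a measure"
    and z :: "nat \<Rightarrow> 'a \<Rightarrow> real ^ ('n::finite + 'm::finite)"
    and u :: "nat \<Rightarrow> 'a \<Rightarrow> real"
    and Ax :: "real ^ 'n ^ 'n" and Axy :: "real ^ 'm ^ 'n"
    and Ayx :: "real ^ 'n ^ 'm" and Ay :: "real ^ 'm ^ 'm"
    and Bx :: "real ^ 1 ^ 'n" and By :: "real ^ 1 ^ 'm"
    and A :: "real ^ ('n + 'm) ^ ('n + 'm)" and B :: "real ^ 1 ^ ('n + 'm)"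
    and \<Sigma>x :: "real ^ 'n ^ 'n" and \<Sigma>xy :: "real ^ 'm ^ 'n" and \<Sigma>y :: "real ^ 'm ^ 'm"
    and \<Sigma>u :: "real ^ 1 ^ 1" and \<Sigma>xs :: "real ^ 'm ^ 'm"
    and b c :: real and t :: nat
  assumes prob: "prob_space M"
    and base: "b > 1"
    and A_def: "A = block_matrix Ax Axy Ayx Ay"
    and B_def: "B = block_column Bx By"
    and system: "\<And>s \<omega>. \<omega> \<in> space M \<Longrightarrow> z (Suc s) \<omega> = system_step A B (z s \<omega>) (u s \<omega>)"
    and u_indep: "prob_space.indep_vars M (\<lambda>_. borel) u UNIV"
    and u_ident: "\<And>s s'. distr M borel (u s) = distr M borel (u s')"
    and u_white: "\<And>s k. k \<noteq> 0 \<Longrightarrow> prob_space.expectation M (\<lambda>\<omega>. u s \<omega> * u (s + k) \<omega>) = 0"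
    and zu_gaussian: "\<And>s. gaussian M (\<lambda>\<omega>. (z s \<omega>, u s \<omega>))"
    and zu_uncorrelated: "\<And>s. prob_space.expectation M (\<lambda>\<omega>. u s \<omega> *\<^sub>R z s \<omega>) = 0"
    and cov_z: "covariance_matrix M (z t) = block_matrix \<Sigma>x \<Sigma>xy (transpose \<Sigma>xy) \<Sigma>y"
    and cov_u: "covariance_matrix M (\<lambda>\<omega>. vec (u t \<omega>)) = \<Sigma>u"
    and \<Sigma>xs_def: "\<Sigma>xs = schur_complement \<Sigma>x \<Sigma>xy \<Sigma>y"
    and \<Sigma>x_invertible: "invertible \<Sigma>x"
    and frozen_nondegenerate: "invertible (Axy ** \<Sigma>xs ** transpose Axy)"
  shows "input_transfer b M A B c z t =
    1 / 2 * log b (det (Axy ** \<Sigma>xs ** transpose Axy + Bx ** \<Sigma>u ** transpose Bx)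
                   / det (Axy ** \<Sigma>xs ** transpose Axy))"
proof -
  interpret prob_space M by fact
  interpret information_space M b
    by standard (rule base)
  define X where "X \<omega> = upper_part (z t \<omega>)" for \<omega>
  define Y where "Y \<omega> = lower_part (z t \<omega>)" for \<omega>
  define U :: "'a \<Rightarrow> real ^ 1" where "U \<omega> = vec (u t \<omega>)" for \<omega>
  \<comment> \<open>The sign is built into \<open>K\<close> so that the regression residual is a
    sum, to which the additivity rules for covariances apply.\<close>
  define K where "K = - (transpose \<Sigma>xy ** matrix_inv \<Sigma>x)"
  define Y' where "Y' \<omega> = Y \<omega> + K *v X \<omega>" for \<omega>
  define R\<^sub>0 where "R\<^sub>0 \<omega> = Axy *v Y' \<omega>" for \<omega>
  define R where "R \<omega> = R\<^sub>0 \<omega> + Bx *v U \<omega>" for \<omega>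

  \<comment> \<open>Gaussianity and finite second moments\<close>
  have z_gaussian: "gaussian M (z t)" and u_gaussian: "gaussian M (u s)" for s
    using gaussian_linear[OF zu_gaussian linear_fst] gaussian_linear[OF zu_gaussian linear_snd] by simp_all
  have "linear (\<lambda>v. vec v :: real ^ 1)"
    by (rule linearI) (simp_all add: vec_eq_iff)
  then have U_gaussian: "gaussian M U"
    unfolding U_def by (rule gaussian_linear[OF u_gaussian])
  have X_gaussian: "gaussian M X" and Y_gaussian: "gaussian M Y"
    unfolding X_def Y_def by (intro gaussian_linear[OF z_gaussian] linear_upper_part linear_lower_part)+
  note sq = gaussian_vec_sq_integrable[OF prob_space_axioms]
  note X_sq = sq[OF X_gaussian] and Y_sq = sq[OF Y_gaussian] and U_sq = sq[OF U_gaussian]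
  have Y'_sq: "vec_sq_integrable M Y'"
    unfolding Y'_def by (intro vec_sq_integrable_add vec_sq_integrable_matrix X_sq Y_sq)
  have R\<^sub>0_sq: "vec_sq_integrable M R\<^sub>0"
    unfolding R\<^sub>0_def by (intro vec_sq_integrable_matrix Y'_sq)
  have BU_sq: "vec_sq_integrable M (\<lambda>\<omega>. Bx *v U \<omega>)"
    by (intro vec_sq_integrable_matrix U_sq)
  have u_sq: "sq_integrable M (u s)" for s
    using gaussian_sq_integrable[OF prob_space_axioms u_gaussian, of 1 s] by simp
  have u_mean: "expectation (u t) = 0"
    using white_noise_mean_zero[OF u_indep u_ident u_white sq_integrable_imp_integrable[OF u_sq]] by simp

  \<comment> \<open>Covariances of the residual and of the two noises\<close>
  note XX = cross_covariance_blocks(1)[OF cov_z, folded X_def]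
    and XY = cross_covariance_blocks(2)[OF cov_z, folded X_def Y_def]
    and YY = cross_covariance_blocks(3)[OF cov_z, folded Y_def]
  have YX: "cross_covariance M Y X = transpose \<Sigma>xy"
    by (simp add: XY[symmetric] cross_covariance_transpose)
  have UU: "cross_covariance M U U = \<Sigma>u"
    using cov_u by (simp add: covariance_matrix_eq_cross_covariance U_def[abs_def])
  have uz: "covariance M (u t) (\<lambda>\<omega>. z t \<omega> $ k) = 0" for k
  proof -
    have "sq_integrable M (\<lambda>\<omega>. z t \<omega> $ k)"
      using sq[OF z_gaussian] by (simp add: vec_sq_integrable_def)
    then have "covariance M (u t) (\<lambda>\<omega>. z t \<omega> $ k) = expectation (\<lambda>\<omega>. u t \<omega> * z t \<omega> $ k)"
      by (simp add: covariance_eq u_sq u_mean)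
    also have "\<dots> = 0"
      using integral_scaleR_vec_nth[OF u_sq[of t] sq[OF z_gaussian], of k] zu_uncorrelated[of t] by simp
    finally show ?thesis .
  qed
  have UX: "cross_covariance M U X = 0" and UY: "cross_covariance M U Y = 0"
    by (simp_all add: cross_covariance_def U_def X_def Y_def upper_part_def lower_part_def vec_eq_iff uz)

  have Y'X: "cross_covariance M Y' X = 0"
  proof -
    have "cross_covariance M Y' X = transpose \<Sigma>xy + K ** \<Sigma>x"
      unfolding Y'_def
      by (simp add: cross_covariance_add_left cross_covariance_matrix_left vec_sq_integrable_matrix X_sq Y_sq XX YX)
    also have "K ** \<Sigma>x = - transpose \<Sigma>xy"
      by (simp add: K_def matrix_mult_minus_left matrix_mul_assoc[symmetric] matrix_inv_left[OF \<Sigma>x_invertible])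
    finally show ?thesis
      by simp
  qed
  have Y'Y': "cross_covariance M Y' Y' = \<Sigma>xs"
  proof -
    \<comment> \<open>Only the second argument is expanded: its \<open>K\<close> part is killed by
      \<open>Y'X\<close>, and expanding the first argument of what remains gives the Schur
      complement directly.\<close>
    have "cross_covariance M Y' Y' = cross_covariance M Y' Y + cross_covariance M Y' X ** transpose K"
      by (subst (2) Y'_def[abs_def])
        (simp add: cross_covariance_add_right cross_covariance_matrix_right vec_sq_integrable_matrix X_sq Y_sq Y'_sq)
    also have "\<dots> = cross_covariance M Y' Y"
      by (simp add: Y'X)
    also have "\<dots> = \<Sigma>y + K ** \<Sigma>xy"
      unfolding Y'_def
      by (simp add: cross_covariance_add_left cross_covariance_matrix_left vec_sq_integrable_matrix X_sq Y_sq XY YY)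
    finally show ?thesis
      by (simp add: \<Sigma>xs_def schur_complement_def K_def matrix_mult_minus_left)
  qed
  have UY': "cross_covariance M U Y' = 0"
    unfolding Y'_def
    by (simp add: cross_covariance_add_right cross_covariance_matrix_right vec_sq_integrable_matrix X_sq Y_sq U_sq UX UY)

  have R\<^sub>0X: "cross_covariance M R\<^sub>0 X = 0"
    unfolding R\<^sub>0_def by (simp add: cross_covariance_matrix_left X_sq Y'_sq Y'X)
  have R\<^sub>0R\<^sub>0: "cross_covariance M R\<^sub>0 R\<^sub>0 = Axy ** \<Sigma>xs ** transpose Axy"
    unfolding R\<^sub>0_def
    by (simp add: cross_covariance_matrix_left cross_covariance_matrix_right vec_sq_integrable_matrix Y'_sq Y'Y' matrix_mul_assoc)
  have BUBU: "cross_covariance M (\<lambda>\<omega>. Bx *v U \<omega>) (\<lambda>\<omega>. Bx *v U \<omega>) = Bx ** \<Sigma>u ** transpose Bx"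
    by (simp add: cross_covariance_matrix_left cross_covariance_matrix_right vec_sq_integrable_matrix U_sq UU matrix_mul_assoc)
  have BUR\<^sub>0: "cross_covariance M (\<lambda>\<omega>. Bx *v U \<omega>) R\<^sub>0 = 0"
    unfolding R\<^sub>0_def
    by (simp add: cross_covariance_matrix_left cross_covariance_matrix_right vec_sq_integrable_matrix U_sq Y'_sq UY')
  have R\<^sub>0BU: "cross_covariance M R\<^sub>0 (\<lambda>\<omega>. Bx *v U \<omega>) = 0"
    using cross_covariance_transpose[of "\<lambda>\<omega>. Bx *v U \<omega>" R\<^sub>0] by (simp add: BUR\<^sub>0 transpose_def vec_eq_iff)
  have RX: "cross_covariance M R X = 0"
    unfolding R_def
    by (simp add: cross_covariance_add_left cross_covariance_matrix_left vec_sq_integrable_matrix X_sq U_sq R\<^sub>0_sq R\<^sub>0X UX)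
  have RR: "cross_covariance M R R = Axy ** \<Sigma>xs ** transpose Axy + Bx ** \<Sigma>u ** transpose Bx"
    unfolding R_def
    by (simp add: cross_covariance_add_left cross_covariance_add_right vec_sq_integrable_add R\<^sub>0_sq BU_sq R\<^sub>0R\<^sub>0 BUBU BUR\<^sub>0 R\<^sub>0BU)

  \<comment> \<open>Positive definiteness\<close>
  have X_pos: "0 < v \<bullet> (cross_covariance M X X *v v)" if "v \<noteq> 0" for v
    by (rule covariance_matrix_pos_def[OF X_sq _ that]) (simp add: XX \<Sigma>x_invertible)
  have R\<^sub>0_pos: "0 < v \<bullet> (cross_covariance M R\<^sub>0 R\<^sub>0 *v v)" if "v \<noteq> 0" for v
    by (rule covariance_matrix_pos_def[OF R\<^sub>0_sq _ that]) (simp add: R\<^sub>0R\<^sub>0 frozen_nondegenerate)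
  \<comment> \<open>The summand contributed by the input is itself a covariance matrix, hence
    positive semidefinite, so positive definiteness passes from \<open>R\<^sub>0\<close> to
    \<open>R\<close>.\<close>
  have R_pos: "0 < v \<bullet> (cross_covariance M R R *v v)" if "v \<noteq> 0" for v
  proof -
    have "0 \<le> covariance M (\<lambda>\<omega>. v \<bullet> (Bx *v U \<omega>)) (\<lambda>\<omega>. v \<bullet> (Bx *v U \<omega>))"
      by (simp add: covariance_def)
    then have "0 \<le> v \<bullet> ((Bx ** \<Sigma>u ** transpose Bx) *v v)"
      by (simp add: covariance_inner[OF BU_sq BU_sq] BUBU)
    then show ?thesis
      using R\<^sub>0_pos[OF that] by (simp add: RR R\<^sub>0R\<^sub>0 matrix_vector_mult_add_rdistrib inner_add_right)
  qed

  \<comment> \<open>Noise and state are obtained from \<open>(z t, u t)\<close> by a single linear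
    map, so their joint Gaussianity is inherited and not merely that of each component.\<close>
  have "linear (\<lambda>(z, v). (Axy *v (lower_part z + K *v upper_part z), upper_part z) ::
      (real ^ 'n) \<times> (real ^ 'n))"
    by (rule linearI) (auto simp: linear_add[OF linear_upper_part] linear_add[OF linear_lower_part]
        linear_scale[OF linear_upper_part] linear_scale[OF linear_lower_part]
        matrix_vector_right_distrib matrix_vector_mult_scaleR scaleR_add_right)
  from gaussian_linear[OF zu_gaussian[of t] this]
  have R\<^sub>0X_gaussian: "gaussian M (\<lambda>\<omega>. (R\<^sub>0 \<omega>, X \<omega>))"
    by (simp add: R\<^sub>0_def Y'_def X_def Y_def)
  have "linear (\<lambda>(z, v). (Axy *v (lower_part z + K *v upper_part z) + Bx *v vec v, upper_part z) ::
      (real ^ 'n) \<times> (real ^ 'n))"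
    by (rule linearI) (auto simp: linear_add[OF linear_upper_part] linear_add[OF linear_lower_part]
        linear_scale[OF linear_upper_part] linear_scale[OF linear_lower_part] linear_add[OF \<open>linear (\<lambda>v. vec v :: real ^ 1)\<close>]
        linear_scale[OF \<open>linear (\<lambda>v. vec v :: real ^ 1)\<close>, simplified]
        matrix_vector_right_distrib matrix_vector_mult_scaleR scaleR_add_right)
  from gaussian_linear[OF zu_gaussian[of t] this]
  have RX_gaussian: "gaussian M (\<lambda>\<omega>. (R \<omega>, X \<omega>))"
    by (simp add: R_def R\<^sub>0_def Y'_def X_def Y_def U_def)

  \<comment> \<open>The two conditional entropies and their difference\<close>
  define G where "G = Ax - Axy ** K"
  \<comment> \<open>Substituting \<open>Y = Y' - K X\<close> in the block equation leaves
    \<open>Ax - Axy ** K\<close> as the coefficient of \<open>X\<close>.\<close>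
  have step: "upper_part (system_step A B (z t \<omega>) v) = G *v X \<omega> + Bx *v vec v + R\<^sub>0 \<omega>" for \<omega> v
    by (simp add: A_def B_def upper_part_system_step G_def R\<^sub>0_def Y'_def X_def Y_def
        matrix_vector_mult_diff_rdistrib matrix_vector_right_distrib matrix_vector_mul_assoc)
  \<comment> \<open>The constant input is grouped with the function of \<open>X\<close>, so it does
    not affect the noise covariance.\<close>
  have frozen: "upper_part (system_step A B (z t \<omega>) c) = (G *v X \<omega> + Bx *v vec c) + R\<^sub>0 \<omega>" for \<omega>
    by (simp add: step)
  have driven: "upper_part (z (Suc t) \<omega>) = G *v X \<omega> + R \<omega>" if "\<omega> \<in> space M" for \<omega>
    by (simp add: system[OF that] step R_def U_def algebra_simps)
  have meas: "(\<lambda>x. G *v x + Bx *v vec c) \<in> borel_measurable borel" "(\<lambda>x. G *v x) \<in> borel_measurable borel"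
    by measurable
  note frozen_entropy = conditional_entropy_gaussian[OF R\<^sub>0X_gaussian R\<^sub>0X R\<^sub>0_pos X_pos meas(1) frozen]
  note driven_entropy = conditional_entropy_gaussian[OF RX_gaussian RX R_pos X_pos meas(2) driven]
  have "input_transfer b M A B c z t =
      1 / 2 * log b (det (cross_covariance M R R)) - 1 / 2 * log b (det (cross_covariance M R\<^sub>0 R\<^sub>0))"
    unfolding input_transfer_def X_def[symmetric]
    using frozen_entropy(2) driven_entropy(2) by simp
  \<comment> \<open>Both determinants are positive, so the difference of logarithms is the logarithm
    of the quotient.\<close>
  moreover note frozen_entropy(1) driven_entropy(1)
  ultimately show ?thesis
    by (simp add: log_divide RR R\<^sub>0R\<^sub>0 diff_divide_distrib)
qed

end
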